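(* Let $G$ be a graph. If $G$ is Hamiltonian and its minimum degree satisfies $\delta(G) \ge 600\,\alpha(G)$, then $G$ is pancyclic. In particular, if $G$ is any graph with $\kappa(G) \ge 600\,\alpha(G)$, then $G$ is pancyclic.
   Context: Graphs are finite, simple and undirected, with nonempty vertex set. A graph $G$ on $n$ vertices is Hamiltonian if it contains a cycle of length $n$ (a cycle passing through all vertices), and pancyclic if it contains a cycle of length $\ell$ for every integer $\ell$ with $3 \le \ell \le n$. $\delta(G)$ is the minimum degree of $G$. $\alpha(G)$ is the independence number, i.e. the size of the largest subset of the vertex set that does not contain an edge. $\kappa(G)$ is the (vertex) connectivity, i.e. the size of the smallest subset of the vertex set that can be deleted to obtain a disconnected graph (with the usual convention $\kappa(K_n)=n-1$ for complete graphs). *)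

theory Defs
  imports "Graph_Theory.Graph_Theory"
begin

text \<open>
  Finite simple undirected graphs are rendered by the locale predicate \<^const>\<open>graph\<close>: finite,
  loop-free, symmetric digraphs without parallel arcs, so an edge uv is the pair of opposite arcs
  (u,v) and (v,u). That predicate admits the graph without vertices, which has to be excluded
  separately.
\<close>

text \<open>
  In a symmetric digraph, \<^const>\<open>pre_digraph.cycle\<close> also accepts u, v, u, i.e.\ an edge traversed back
  and forth. The cycles of the underlying simple graph are exactly those of length at least 3.
\<close>

definition simple_cycle :: "('a, 'b) pre_digraph \<Rightarrow> 'b awalk \<Rightarrow> bool" where
  "simple_cycle G p \<longleftrightarrow> pre_digraph.cycle G p \<and> 3 \<le> length p"

definition hamiltonian :: "('a, 'b) pre_digraph \<Rightarrow> bool" where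
  "hamiltonian G \<longleftrightarrow> (\<exists>p. simple_cycle G p \<and> length p = card (verts G))"

definition pancyclic :: "('a, 'b) pre_digraph \<Rightarrow> bool" where
  "pancyclic G \<longleftrightarrow> (\<forall>l. 3 \<le> l \<and> l \<le> card (verts G) \<longrightarrow> (\<exists>p. simple_cycle G p \<and> length p = l))"

text \<open>Every edge at v contributes exactly one outgoing arc, so the degree is \<^const>\<open>out_degree\<close>.\<close>

definition min_degree :: "('a, 'b) pre_digraph \<Rightarrow> nat" where
  "min_degree G = Min (out_degree G ` verts G)"

definition independent_set :: "('a, 'b) pre_digraph \<Rightarrow> 'a set \<Rightarrow> bool" where
  "independent_set G S \<longleftrightarrow> S \<subseteq> verts G \<and> (\<forall>u\<in>S. \<forall>v\<in>S. \<not> u \<rightarrow>\<^bsub>G\<^esub> v)"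

definition independence_number :: "('a, 'b) pre_digraph \<Rightarrow> nat" where
  "independence_number G = Max (card ` {S. independent_set G S})"

text \<open>
  The library counts the graph without vertices as not connected, so deleting all vertices must be
  excluded. Complete graphs have no vertex cut; the convention for them is a separate case.
\<close>

definition vertex_cut :: "('a, 'b) pre_digraph \<Rightarrow> 'a set \<Rightarrow> bool" where
  "vertex_cut G S \<longleftrightarrow> S \<subset> verts G \<and> \<not> connected (G \<restriction> (verts G - S))"

definition vertex_connectivity :: "('a, 'b) pre_digraph \<Rightarrow> nat" where
  "vertex_connectivity G =
     (if complete_digraph (card (verts G)) G then card (verts G) - 1
      else Min (card ` {S. vertex_cut G S}))"

end

theory Submission
  imports Defs
begin

text \<open>
  Let \<open>k\<close> be the independence number. Any path on more than \<open>2 * k\<close> vertices has a chord that skips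
  fewer than \<open>2 * k\<close> vertices, and a vertex with more than \<open>k\<close> neighbours on a cycle can be inserted
  into it. So it is enough to produce, for a target length \<open>l\<close>, cycles whose lengths fill a window of
  about \<open>2 * k\<close> consecutive values.

  For \<open>l > 6 * k\<close>, split the Hamiltonian cycle into an arc \<open>A\<close> with \<open>l - 2 * k\<close> vertices and the
  rest \<open>B\<close>. If \<open>2 * k\<close> vertices of \<open>B\<close> have more than \<open>k\<close> neighbours in \<open>A\<close>, shorten \<open>B\<close> to at
  most \<open>2 * k\<close> vertices and insert as many of those as needed. Otherwise \<open>B\<close> contains a set of large
  minimum degree, hence by Mader's theorem a highly connected set \<open>D\<close>. Enter \<open>D\<close> at its first vertex
  on \<open>B\<close> and leave it at its last one; on the way a chain of \<open>2 * k\<close> triangles, each of which may be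
  short-cut, makes the length flexible, and the part outside the chain is shortened by chords.

  For \<open>l \<le> 6 * k\<close>, consider the breadth-first layers around a vertex. If \<open>l\<close> is missed, no two
  consecutive layers among the first \<open>l / 6\<close> are dense enough to carry a chain of triangles, because
  its ends could be joined through the tree. Counting edges, the layers then grow so fast that one of
  them would contain an independent set with more than \<open>k\<close> vertices.

  For highly connected graphs a Hamiltonian cycle is supplied by the argument of Chvatal and Erdos.
\<close>

section \<open>Paths and cycles in graphs of bounded independence number\<close>

text \<open>Only adjacency is kept; arcs return in the last section. The independence number enters
  through \<open>edge_in_large\<close>.\<close>

locale alpha_graph =
  fixes V :: "'a set" and E :: "'a \<Rightarrow> 'a \<Rightarrow> bool" and k :: nat
  assumes finite_V: "finite V"
    and sym: "E u v \<Longrightarrow> E v u"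
    and irrefl: "\<not> E u u"
    and E_in_V: "E u v \<Longrightarrow> u \<in> V"
    and edge_in_large: "\<lbrakk>X \<subseteq> V; card X > k\<rbrakk> \<Longrightarrow> \<exists>u\<in>X. \<exists>v\<in>X. E u v"
    and k_pos: "0 < k"
begin

section \<open>Neighbourhoods, and paths and cycles as vertex lists\<close>

definition nb :: "'a \<Rightarrow> 'a set \<Rightarrow> 'a set" where
  "nb u X = {v\<in>X. E u v}"

definition deg :: "'a \<Rightarrow> 'a set \<Rightarrow> nat" where
  "deg u X = card (nb u X)"

text \<open>One-vertex lists count as paths, so inserted pieces may be trivial. Such a list is not
  forced into \<open>V\<close>, hence the length condition in
  \<open>is_path_subset_V\<close>.\<close>

definition is_path :: "'a list \<Rightarrow> bool" where
  "is_path xs \<longleftrightarrow> xs \<noteq> [] \<and> distinct xs \<and> successively E xs"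

definition is_cycle :: "'a list \<Rightarrow> bool" where
  "is_cycle xs \<longleftrightarrow> 3 \<le> length xs \<and> distinct xs \<and> successively E xs \<and> E (last xs) (hd xs)"

lemma E_in_V2: "E u v \<Longrightarrow> v \<in> V"
  using sym E_in_V by blast

lemma E_commute: "E u v \<longleftrightarrow> E v u"
  using sym by blast

lemma nb_subset: "nb u X \<subseteq> X" and nb_V: "nb u X \<subseteq> V"
  by (auto simp: nb_def E_in_V2)

lemma finite_nb [simp]: "finite (nb u X)"
  using finite_V nb_V finite_subset by blast

lemma deg_mono: "X \<subseteq> Y \<Longrightarrow> deg u X \<le> deg u Y"
  unfolding deg_def by (intro card_mono finite_nb) (auto simp: nb_def)

lemma deg_Un_le: "deg u (X \<union> Y) \<le> deg u X + deg u Y"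
proof -
  have "nb u (X \<union> Y) = nb u X \<union> nb u Y"
    by (auto simp: nb_def)
  then show ?thesis
    unfolding deg_def by (metis card_Un_le)
qed

lemma deg_le_card: "finite X \<Longrightarrow> deg u X \<le> card X"
  unfolding deg_def by (rule card_mono[OF _ nb_subset])

lemma card_nb_minus: "finite U \<Longrightarrow> deg u X - card U \<le> card (nb u X - U)"
  unfolding deg_def by (rule diff_card_le_card_Diff)

lemma successively_converse_E [simp]: "successively (\<lambda>x y. E y x) xs = successively E xs"
  using E_commute by (intro successively_cong) auto

lemma is_path_subset_V:
  assumes "successively E xs" "2 \<le> length xs"
  shows "set xs \<subseteq> V"
proof
  fix x assume "x \<in> set xs"
  then obtain i where i: "i < length xs" "x = xs ! i"
    by (metis in_set_conv_nth)
  show "x \<in> V"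
  proof (cases "Suc i < length xs")
    case True
    then show ?thesis
      using assms(1) i E_in_V successively_nth by metis
  next
    case False
    then have "Suc (i - 1) < length xs" "i = Suc (i - 1)"
      using i assms(2) by auto
    then show ?thesis
      using assms(1) i E_in_V2 successively_nth by metis
  qed
qed

lemma is_cycle_subset_V: "is_cycle xs \<Longrightarrow> set xs \<subseteq> V"
  unfolding is_cycle_def by (intro is_path_subset_V) auto

text \<open>The Chvatal-Erdos detour: leave at the end of \<open>A\<close>, return through
  \<open>Q\<close> to the end of \<open>B\<close>, run \<open>B\<close> backwards and jump from its
  first vertex to the successor of \<open>B\<close>, which is the head of \<open>A\<close> if
  \<open>C\<close> is empty.\<close>

lemma is_cycle_insert:
  assumes cyc: "is_cycle (A @ B @ C)" and ne: "A \<noteq> []" "B \<noteq> []"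
    and Q: "is_path Q" "set Q \<inter> set (A @ B @ C) = {}"
    and edges: "E (last A) (hd Q)" "E (last Q) (last B)" "E (hd B) (hd (C @ A))"
  shows "is_cycle (A @ Q @ rev B @ C)"
  using assms
  unfolding is_cycle_def is_path_def
  by (cases "C = []") (auto simp: successively_append_iff hd_rev last_rev)

text \<open>Distinct vertices have distinct cyclic successors, so more than \<open>k\<close>
  successors exist and two of them are adjacent. The decomposition is the one that
  \<open>is_cycle_insert\<close> consumes.\<close>

lemma is_cycle_successor_edge:
  assumes cyc: "is_cycle zs" and S: "S \<subseteq> set zs" "card S > k"
  obtains A B C where "zs = A @ B @ C" "A \<noteq> []" "B \<noteq> []" "last A \<in> S" "last B \<in> S"
    "E (hd B) (hd (C @ A))"
proof -
  define m where "m = length zs"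
  define f where "f i = zs ! (Suc i mod m)" for i
  define N where "N = {i. i < m \<and> zs ! i \<in> S}"
  have m: "m \<ge> 3" and dist: "distinct zs"
    using cyc by (auto simp: is_cycle_def m_def)
  have imN: "(\<lambda>i. zs ! i) ` N = S"
    using S by (force simp: N_def m_def in_set_conv_nth)
  have "card N = card S"
    unfolding imN[symmetric]
    by (rule card_image[symmetric])
       (use dist in \<open>auto simp: inj_on_def N_def m_def nth_eq_iff_index_eq\<close>)
  moreover have "inj_on f N"
  proof (rule inj_onI)
    fix i j assume ij: "i \<in> N" "j \<in> N" "f i = f j"
    have "Suc i mod m < m" "Suc j mod m < m"
      using m by auto
    then have "Suc i mod m = Suc j mod m"
      using ij(3) dist by (simp add: f_def m_def nth_eq_iff_index_eq)
    then show "i = j"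
      using ij(1,2) unfolding N_def by (auto simp: mod_Suc split: if_splits)
  qed
  ultimately have "card (f ` N) > k"
    using S(2) by (simp add: card_image)
  moreover have "f ` N \<subseteq> V"
  proof (intro image_subsetI)
    fix i
    have "Suc i mod m < m"
      using m by (intro mod_less_divisor) simp
    then show "f i \<in> V"
      using is_cycle_subset_V[OF cyc] unfolding f_def m_def by (meson nth_mem subsetD)
  qed
  ultimately obtain i j where "i \<in> N" "j \<in> N" "E (f i) (f j)"
    using edge_in_large by blast
  then obtain i j where ij: "i \<in> N" "j \<in> N" "E (f i) (f j)" "i < j"
    using irrefl sym by (metis linorder_neqE_nat)
  define A where "A = take (Suc i) zs"
  define B where "B = take (j - i) (drop (Suc i) zs)"
  define C where "C = drop (Suc j) zs"
  have jm: "j < m" "i < m"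
    using ij by (auto simp: N_def)
  have "zs = A @ B @ C"
  proof -
    have "drop (Suc i) zs = B @ C"
      unfolding B_def C_def using ij(4) append_take_drop_id[of "j - i" "drop (Suc i) zs"]
      by simp
    then show ?thesis
      unfolding A_def by (metis append_take_drop_id)
  qed
  moreover have "A \<noteq> []" "B \<noteq> []"
    using jm ij(4) by (auto simp: A_def B_def m_def)
  moreover have "last A = zs ! i"
    using jm by (simp add: A_def m_def take_Suc_conv_app_nth)
  moreover have "last B = zs ! j"
    using jm ij(4) by (simp add: B_def m_def last_conv_nth)
  moreover have "hd B = f i"
    using jm ij(4) by (simp add: B_def f_def m_def hd_conv_nth)
  moreover have "hd (C @ A) = f j"
  proof (cases "Suc j = m")
    case True
    then show ?thesis
      using m by (simp add: C_def A_def f_def m_def hd_conv_nth)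
         (metis A_def calculation(2) hd_conv_nth hd_take length_greater_0_conv take_eq_Nil zero_less_Suc)
  next
    case False
    then have "Suc j < m"
      using jm by simp
    then show ?thesis
      by (simp add: C_def f_def m_def hd_append hd_drop_conv_nth)
  qed
  ultimately show ?thesis
    using ij that[of A B C] by (auto simp: N_def)
qed

lemma is_cycle_insert_vertex:
  assumes cyc: "is_cycle zs" and w: "w \<notin> set zs" "deg w (set zs) > k"
  obtains zs' where "is_cycle zs'" "set zs' = insert w (set zs)"
proof -
  obtain A B C where *: "zs = A @ B @ C" "A \<noteq> []" "B \<noteq> []"
      "last A \<in> nb w (set zs)" "last B \<in> nb w (set zs)" "E (hd B) (hd (C @ A))"
    using is_cycle_successor_edge[OF cyc nb_subset] w(2) unfolding deg_def by metis
  have "is_cycle (A @ [w] @ rev B @ C)"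
    using cyc w(1) * by (intro is_cycle_insert) (auto simp: nb_def is_path_def sym)
  moreover have "set (A @ [w] @ rev B @ C) = insert w (set zs)"
    using * by auto
  ultimately show ?thesis
    using that by blast
qed

lemma is_cycle_insert_vertices:
  assumes cyc: "is_cycle zs" and W: "finite W" "W \<inter> set zs = {}"
    "\<And>w. w \<in> W \<Longrightarrow> deg w (set zs) > k"
  obtains zs' where "is_cycle zs'" "set zs' = W \<union> set zs"
proof -
  have "\<exists>zs'. is_cycle zs' \<and> set zs' = W \<union> set zs"
    using W
  proof (induction W)
    case empty
    then show ?case
      using cyc by auto
  next
    case (insert w W)
    then obtain zs' where zs': "is_cycle zs'" "set zs' = W \<union> set zs"
      by auto
    have "w \<notin> set zs'"
      using insert zs' by auto
    moreover have "deg w (set zs') > k"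
      using insert.prems(2)[of w] zs'(2) deg_mono[of "set zs" "set zs'" w] by fastforce
    ultimately show ?case
      using is_cycle_insert_vertex[OF zs'(1)] zs'(2) by (metis Un_insert_left)
  qed
  then show ?thesis
    using that by blast
qed

text \<open>Among the first \<open>2 * k + 1\<close> vertices, the \<open>k + 1\<close> at even
  positions span an edge. Positions of equal parity are not consecutive, so this edge really
  shortens the path.\<close>

lemma is_path_chord:
  assumes xs: "is_path xs" "length xs > 2 * k"
  obtains ys where "is_path ys" "hd ys = hd xs" "last ys = last xs" "set ys \<subseteq> set xs"
    "length ys < length xs" "length xs < length ys + 2 * k"
proof -
  define f where "f i = xs ! (2 * i)" for i
  have dist: "distinct xs"
    using xs(1) by (simp add: is_path_def)
  have "inj_on f {..k}"
    using dist xs(2) by (auto simp: inj_on_def f_def nth_eq_iff_index_eq)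
  then have "card (f ` {..k}) > k"
    by (simp add: card_image)
  moreover have "f ` {..k} \<subseteq> V"
    using is_path_subset_V[of xs] xs k_pos by (auto simp: f_def is_path_def)
  ultimately obtain i j where "i \<le> k" "j \<le> k" "E (f i) (f j)"
    using edge_in_large[of "f ` {..k}"] by blast
  then obtain i j where ij: "i < j" "j \<le> k" "E (xs ! (2 * i)) (xs ! (2 * j))"
    using irrefl sym unfolding f_def by (metis linorder_neqE_nat)
  define ys where "ys = take (Suc (2 * i)) xs @ drop (2 * j) xs"
  have len: "length ys = length xs - (2 * j - 2 * i - 1)"
    using ij xs(2) by (simp add: ys_def)
  have "set (take (Suc (2 * i)) xs) \<inter> set (drop (2 * j) xs) = {}"
    using dist ij(1) by (intro set_take_disj_set_drop_if_distinct) auto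
  moreover have "last (take (Suc (2 * i)) xs) = xs ! (2 * i)"
    using ij xs(2) by (simp add: take_Suc_conv_app_nth)
  moreover have "hd (drop (2 * j) xs) = xs ! (2 * j)"
    using ij xs(2) by (simp add: hd_drop_conv_nth)
  moreover have "successively E (take n xs)" "successively E (drop n xs)" for n
    using xs(1) successively_append_iff[of E "take n xs" "drop n xs"]
    by (simp_all add: is_path_def)
  ultimately have "is_path ys"
    using dist ij xs unfolding is_path_def ys_def
    by (auto simp: successively_append_iff)
  moreover have "hd ys = hd xs" "last ys = last xs" "set ys \<subseteq> set xs"
    using ij xs(2) unfolding ys_def
    by (auto simp: hd_append dest: in_set_takeD in_set_dropD)
  moreover have "length ys < length xs" "length xs < length ys + 2 * k"
    using len ij xs(2) by auto
  ultimately show ?thesis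
    using that by blast
qed

text \<open>Apply chords until the length is at most \<open>T\<close>. Each one removes fewer than
  \<open>2 * k\<close> vertices, which bounds the undershoot; \<open>2 * k \<le> T\<close> keeps a
  chord available until then.\<close>

lemma is_path_shorten:
  assumes xs: "is_path xs" and T: "2 * k \<le> T"
  obtains ys where "is_path ys" "hd ys = hd xs" "last ys = last xs" "set ys \<subseteq> set xs"
    "length ys \<le> T" "length xs < T \<or> T < length ys + 2 * k"
proof -
  have "\<exists>ys. is_path ys \<and> hd ys = hd xs \<and> last ys = last xs \<and> set ys \<subseteq> set xs \<and>
    length ys \<le> T \<and> (length xs < T \<or> T < length ys + 2 * k)"
    using xs
  proof (induction "length xs" arbitrary: xs rule: less_induct)
    case less
    show ?case
    proof (cases "length xs \<le> T")
      case True
      then show ?thesis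
        using less.prems k_pos by auto
    next
      case False
      then obtain ys where ys: "is_path ys" "hd ys = hd xs" "last ys = last xs" "set ys \<subseteq> set xs"
          "length ys < length xs" "length xs < length ys + 2 * k"
        using is_path_chord[OF less.prems] T by auto
      show ?thesis
      proof (cases "length ys < T")
        case True
        then show ?thesis
          using ys False by (intro exI[of _ ys]) auto
      next
        case ge: False
        then show ?thesis
          using less.hyps[OF ys(5,1)] ys by fastforce
      qed
    qed
  qed
  then show ?thesis
    using that by blast
qed

text \<open>The unit of the chain is a triangle \<open>p, u, v\<close> with \<open>p \<in> X\<close> and \<open>u, v \<in> Y\<close>, which can be
  traversed with or without \<open>u\<close>, followed by a step from \<open>v\<close> back to \<open>X\<close>.\<close>

lemma flexible_chain:
  assumes x: "x \<in> X" "x \<noteq> y"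
    and X: "\<And>x. x \<in> X \<Longrightarrow> k + 3 * t \<le> deg x Y"
    and Y: "\<And>y. y \<in> Y \<Longrightarrow> 3 * t + 1 \<le> deg y X"
  obtains p U where "p \<in> X" "p \<in> U" "x \<in> U" "U \<subseteq> X \<union> Y" "y \<notin> U" "finite U" "card U \<le> 3 * t + 1"
    "t = 0 \<or> p \<noteq> x"
    "\<forall>m\<in>{2 * t + 1..3 * t + 1}.
      \<exists>xs. is_path xs \<and> hd xs = x \<and> last xs = p \<and> set xs \<subseteq> U \<and> length xs = m"
proof -
  have "s \<le> t \<Longrightarrow> \<exists>p U. p \<in> X \<and> p \<in> U \<and> x \<in> U \<and> U \<subseteq> X \<union> Y \<and> y \<notin> U \<and> finite U \<and> card U \<le> 3 * s + 1 \<and>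
    (0 < s \<longrightarrow> p \<noteq> x) \<and>
    (\<forall>m. 2 * s + 1 \<le> m \<and> m \<le> 3 * s + 1 \<longrightarrow>
      (\<exists>xs. is_path xs \<and> hd xs = x \<and> last xs = p \<and> set xs \<subseteq> U \<and> length xs = m))" for s
  proof (induction s)
    case 0
    have "is_path [x]"
      by (simp add: is_path_def)
    then have "\<exists>xs. is_path xs \<and> hd xs = x \<and> last xs = x \<and> set xs \<subseteq> {x} \<and> length xs = Suc 0"
      by (intro exI[of _ "[x]"]) auto
    then show ?case
      using x by (intro exI[of _ x] exI[of _ "{x}"]) (auto simp: le_antisym)
  next
    case (Suc s)
    then obtain p U where p: "p \<in> X" "p \<in> U" "x \<in> U" "U \<subseteq> X \<union> Y" "y \<notin> U" "finite U" "card U \<le> 3 * s + 1"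
      and U: "\<And>m. 2 * s + 1 \<le> m \<Longrightarrow> m \<le> 3 * s + 1 \<Longrightarrow>
        \<exists>xs. is_path xs \<and> hd xs = x \<and> last xs = p \<and> set xs \<subseteq> U \<and> length xs = m"
      by (auto simp: less_eq_Suc_le)
    \<comment> \<open>At most \<open>3 * s + 2 < 3 * t\<close> vertices are forbidden, so more than
      \<open>k\<close> neighbours of \<open>p\<close> remain and two of them are adjacent.\<close>
    have "card (insert y U) \<le> 3 * s + 2"
      using p by simp
    then have "k < card (nb p Y - insert y U)"
      using card_nb_minus[of "insert y U" p Y] X[OF p(1)] Suc.prems p by simp
    then obtain u v where uv: "u \<in> nb p Y - insert y U" "v \<in> nb p Y - insert y U" "E u v"
      using edge_in_large[of "nb p Y - insert y U"] nb_V by blast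
    \<comment> \<open>With \<open>u\<close> forbidden as well, at most \<open>3 * t\<close> vertices
      are excluded, leaving \<open>v\<close> a fresh neighbour in \<open>X\<close>.\<close>
    have "card (insert u (insert y U)) \<le> 3 * s + 3"
      using p by (simp add: card_insert_if)
    moreover have "3 * s + 3 + 1 \<le> deg v X"
      using Y[of v] uv Suc.prems by (auto simp: nb_def)
    ultimately have "0 < card (nb v X - insert u (insert y U))"
      using card_nb_minus[of "insert u (insert y U)" v X] p(6) by simp
    then obtain q where q: "q \<in> nb v X - insert u (insert y U)"
      by (metis card_eq_0_iff ex_in_conv less_not_refl)
    define U' where "U' = insert q (insert u (insert v U))"
    have "card U' \<le> 3 * Suc s + 1"
      using p by (simp add: U'_def card_insert_if)
    moreover have "\<exists>xs. is_path xs \<and> hd xs = x \<and> last xs = q \<and> set xs \<subseteq> U' \<and> length xs = m"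
      if m: "2 * Suc s + 1 \<le> m" "m \<le> 3 * Suc s + 1" for m
    \<comment> \<open>Skipping \<open>u\<close> adds two vertices, visiting it three; only the
      largest length \<open>3 * s + 4\<close> requires the visit.\<close>
    proof (cases "m - 2 \<le> 3 * s + 1")
      case True
      then obtain xs where xs: "is_path xs" "hd xs = x" "last xs = p" "set xs \<subseteq> U" "length xs = m - 2"
        using U[of "m - 2"] le_diff_conv2[of 2 m "2 * s + 1"] m by auto
      then have "is_path (xs @ [v, q])"
        using uv q irrefl by (auto simp: is_path_def successively_append_iff nb_def)
      then show ?thesis
        using xs m by (intro exI[of _ "xs @ [v, q]"]) (auto simp: U'_def is_path_def)
    next
      case False
      then obtain xs where xs: "is_path xs" "hd xs = x" "last xs = p" "set xs \<subseteq> U" "length xs = m - 3"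
        using U[of "m - 3"] le_diff_conv2[of 3 m "2 * s + 1"] le_diff_conv[of m 3 "3 * s + 1"] m
        by auto
      then have "is_path (xs @ [u, v, q])"
        using uv q irrefl by (auto simp: is_path_def successively_append_iff nb_def)
      then show ?thesis
        using xs m by (intro exI[of _ "xs @ [u, v, q]"]) (auto simp: U'_def is_path_def)
    qed
    moreover have "q \<in> X" "q \<in> U'" "x \<in> U'" "U' \<subseteq> X \<union> Y" "y \<notin> U'" "finite U'" "q \<noteq> x"
      using p uv q by (auto simp: U'_def nb_def)
    ultimately show ?case
      by blast
  qed
  from this[of t] obtain p U where
    "p \<in> X" "p \<in> U" "x \<in> U" "U \<subseteq> X \<union> Y" "y \<notin> U" "finite U" "card U \<le> 3 * t + 1"
    "0 < t \<longrightarrow> p \<noteq> x"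
    "\<forall>m. 2 * t + 1 \<le> m \<and> m \<le> 3 * t + 1 \<longrightarrow>
      (\<exists>xs. is_path xs \<and> hd xs = x \<and> last xs = p \<and> set xs \<subseteq> U \<and> length xs = m)"
    by auto
  then show ?thesis
    by (intro that[of p U]) auto
qed

section \<open>Dense and highly connected subsets\<close>

text \<open>Otherwise a greedy choice works: repeatedly pick a vertex with fewer than
  \<open>s\<close> remaining neighbours and discard it with them. Each pick costs at most
  \<open>s\<close> vertices, so more than \<open>k\<close> independent vertices result.\<close>

lemma exists_min_degree_subset:
  assumes X: "X \<subseteq> V" "k * s < card X"
  obtains X' where "X' \<subseteq> X" "X' \<noteq> {}" "\<And>x. x \<in> X' \<Longrightarrow> s \<le> deg x X'"
proof (rule ccontr)
  assume not: "\<not> thesis"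
  note obtained = that
  have low: "\<exists>x\<in>X'. deg x X' < s" if "X' \<subseteq> X" "X' \<noteq> {}" for X'
  proof (rule ccontr)
    assume "\<not> (\<exists>x\<in>X'. deg x X' < s)"
    then have *: "s \<le> deg x X'" if "x \<in> X'" for x
      using that by (simp add: not_less)
    show False
      using not obtained[OF that *] by contradiction
  qed
  have "\<exists>I\<subseteq>X'. (\<forall>u\<in>I. \<forall>v\<in>I. \<not> E u v) \<and> card X' \<le> s * card I" if "X' \<subseteq> X" for X'
    using that
  proof (induction "card X'" arbitrary: X' rule: less_induct)
    case less
    have fin: "finite X'"
      using finite_subset[OF subset_trans[OF less.prems X(1)] finite_V] .
    show ?case
    proof (cases "X' = {}")
      case False
      then obtain x where x: "x \<in> X'" "deg x X' < s"
        using low[OF less.prems False] by blast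
      define Z where "Z = insert x (nb x X')"
      have Z: "Z \<subseteq> X'" "x \<in> Z"
        using x nb_subset by (auto simp: Z_def)
      have "card Z \<le> s"
        using x(2) by (simp add: Z_def deg_def card_insert_if)
      have "card (X' - Z) < card X'"
        using fin Z by (intro psubset_card_mono) auto
      then obtain I where I: "I \<subseteq> X' - Z" "\<forall>u\<in>I. \<forall>v\<in>I. \<not> E u v" "card (X' - Z) \<le> s * card I"
        using less.hyps[of "X' - Z"] less.prems by blast
      have "card X' \<le> s * card (insert x I)"
      proof -
        have "card (insert x I) = Suc (card I)"
          using I(1) Z fin finite_subset[of I X'] by (intro card_insert_disjoint) auto
        moreover have "card X' = card (X' - Z) + card Z"
          using card_Int_Diff[OF fin, of Z] Z(1) by (simp add: Int_absorb1)
        ultimately show ?thesis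
          using I(3) \<open>card Z \<le> s\<close> by simp
      qed
      moreover have "\<not> E x v" if "v \<in> I" for v
        using that I(1) by (auto simp: Z_def nb_def)
      then have "\<forall>u\<in>insert x I. \<forall>v\<in>insert x I. \<not> E u v"
        using I(2) irrefl sym by blast
      ultimately show ?thesis
        using I(1) x(1) by (intro exI[of _ "insert x I"]) auto
    qed auto
  qed
  from this[of X] obtain I where I: "I \<subseteq> X" "\<forall>u\<in>I. \<forall>v\<in>I. \<not> E u v" "card X \<le> s * card I"
    by auto
  then have "\<not> k < card I"
    using edge_in_large[of I] X(1) by (meson subset_trans)
  then have "s * card I \<le> k * s"
    by (simp add: mult.commute)
  then show False
    using I(3) X(2) by linarith
qed

text \<open>A path on at most \<open>s\<close> vertices extends at its head, whose \<open>s\<close>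
  neighbours cannot all be among the other vertices of the path.\<close>

lemma is_path_in_min_degree:
  assumes X: "X \<noteq> {}" "\<And>x. x \<in> X \<Longrightarrow> s \<le> deg x X"
    and m: "1 \<le> m" "m \<le> s + 1"
  obtains xs where "is_path xs" "set xs \<subseteq> X" "length xs = m"
proof -
  have "m \<le> s + 1 \<Longrightarrow> \<exists>xs. is_path xs \<and> set xs \<subseteq> X \<and> length xs = m"
    using m(1)
  proof (induction m rule: dec_induct)
    case base
    obtain x where "x \<in> X"
      using X(1) by blast
    then show ?case
      by (intro exI[of _ "[x]"]) (auto simp: is_path_def)
  next
    case (step m)
    then obtain xs where xs: "is_path xs" "set xs \<subseteq> X" "length xs = m"
      by auto
    have hd: "hd xs \<in> X"
      using xs by (metis is_path_def list.set_sel(1) subsetD)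
    have "hd xs \<notin> nb (hd xs) X"
      using irrefl by (simp add: nb_def)
    have "\<not> nb (hd xs) X \<subseteq> set xs"
    proof
      assume "nb (hd xs) X \<subseteq> set xs"
      then have "nb (hd xs) X \<subseteq> set (tl xs)"
        using \<open>hd xs \<notin> nb (hd xs) X\<close> xs(1)
        by (metis is_path_def list.collapse set_ConsD subsetD subsetI)
      then have "deg (hd xs) X \<le> card (set (tl xs))"
        unfolding deg_def by (intro card_mono) auto
      also have "\<dots> \<le> m - 1"
        using xs(3) by (metis card_length length_tl)
      finally show False
        using X(2)[OF hd] step by linarith
    qed
    then obtain y where y: "y \<in> X" "E (hd xs) y" "y \<notin> set xs"
      by (auto simp: nb_def)
    then have "is_path (y # xs)"
      using xs(1) sym by (auto simp: is_path_def successively_Cons)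
    then show ?case
      using xs y by (intro exI[of _ "y # xs"]) auto
  qed
  then show ?thesis
    using m that by blast
qed

text \<open>Counts ordered adjacent pairs, so \<open>edges X X\<close> is twice the number of edges
  inside \<open>X\<close>.\<close>

definition edges :: "'a set \<Rightarrow> 'a set \<Rightarrow> nat" where
  "edges X Y = (\<Sum>x\<in>X. deg x Y)"

lemma deg_eq_sum: "finite Y \<Longrightarrow> deg x Y = (\<Sum>y\<in>Y. if E x y then 1 else 0)"
  by (simp add: deg_def nb_def sum.If_cases Int_def)

lemma edges_commute: "finite X \<Longrightarrow> finite Y \<Longrightarrow> edges X Y = edges Y X"
  unfolding edges_def using E_commute
  by (simp add: deg_eq_sum sum.swap[of _ Y X] cong: if_cong)

lemma edges_mono: "finite Y \<Longrightarrow> X \<subseteq> X' \<Longrightarrow> finite X' \<Longrightarrow> Y \<subseteq> Y' \<Longrightarrow> edges X Y \<le> edges X' Y'"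
  unfolding edges_def by (intro order_trans[OF sum_mono sum_mono2]) (auto intro: deg_mono)

lemma edges_remove_left: "finite X \<Longrightarrow> x \<in> X \<Longrightarrow> edges X Y = deg x Y + edges (X - {x}) Y"
  by (simp add: edges_def sum.remove)

lemma edges_remove_right:
  assumes "finite X" "finite Y" "y \<in> Y"
  shows "edges X Y = deg y X + edges X (Y - {y})"
  using edges_remove_left[of Y y X] edges_commute[of X Y] edges_commute[of X "Y - {y}"] assms
  by simp

text \<open>Peel off vertices whose degree into the other set is below its threshold. Either this
  stops at a dense pair, or \<open>X\<close> is used up and every removal cost fewer than
  \<open>a\<close> or \<open>b\<close> edges.\<close>

lemma dense_pair_or_few_edges:
  assumes "finite X" "finite Y"
  obtains (dense) X' Y' where "X' \<subseteq> X" "Y' \<subseteq> Y" "X' \<noteq> {}"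
      "\<And>x. x \<in> X' \<Longrightarrow> a \<le> deg x Y'" "\<And>y. y \<in> Y' \<Longrightarrow> b \<le> deg y X'"
    | (sparse) "edges X Y \<le> a * card X + b * card Y"
proof -
  have "(\<exists>X' Y'. X' \<subseteq> X \<and> Y' \<subseteq> Y \<and> X' \<noteq> {} \<and> (\<forall>x\<in>X'. a \<le> deg x Y') \<and> (\<forall>y\<in>Y'. b \<le> deg y X'))
    \<or> edges X Y \<le> a * card X + b * card Y"
    using assms
  proof (induction "card X + card Y" arbitrary: X Y rule: less_induct)
    case less
    show ?case
    proof (cases "X = {} \<or> ((\<forall>x\<in>X. a \<le> deg x Y) \<and> (\<forall>y\<in>Y. b \<le> deg y X))")
      case True
      then show ?thesis
      proof
        assume "X = {}"
        then show ?thesis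
          by (simp add: edges_def)
      next
        assume "(\<forall>x\<in>X. a \<le> deg x Y) \<and> (\<forall>y\<in>Y. b \<le> deg y X)"
        then show ?thesis
          by (cases "X = {}")
            (simp add: edges_def, intro disjI1 exI[of _ X] exI[of _ Y], simp)
      qed
    next
      case False
      then consider x where "x \<in> X" "deg x Y < a" | y where "y \<in> Y" "deg y X < b"
        by (meson not_le_imp_less)
      then show ?thesis
      proof cases
        case 1
        have c: "card X = Suc (card (X - {x}))"
          using card_Suc_Diff1[OF less.prems(1) 1(1)] by simp
        with less.hyps[of "X - {x}" Y] less.prems
        consider X' Y' where "X' \<subseteq> X - {x}" "Y' \<subseteq> Y" "X' \<noteq> {}"
            "\<forall>x\<in>X'. a \<le> deg x Y'" "\<forall>y\<in>Y'. b \<le> deg y X'"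
          | "edges (X - {x}) Y \<le> a * card (X - {x}) + b * card Y"
          by auto
        then show ?thesis
        proof cases
          case 1
          then show ?thesis
            by (intro disjI1 exI[of _ X'] exI[of _ Y']) auto
        next
          case 2
          then show ?thesis
            using edges_remove_left[OF less.prems(1) \<open>x \<in> X\<close>, of Y] \<open>deg x Y < a\<close> c by simp
        qed
      next
        case 2
        have c: "card Y = Suc (card (Y - {y}))"
          using card_Suc_Diff1[OF less.prems(2) 2(1)] by simp
        with less.hyps[of X "Y - {y}"] less.prems
        consider X' Y' where "X' \<subseteq> X" "Y' \<subseteq> Y - {y}" "X' \<noteq> {}"
            "\<forall>x\<in>X'. a \<le> deg x Y'" "\<forall>y\<in>Y'. b \<le> deg y X'"
          | "edges X (Y - {y}) \<le> a * card X + b * card (Y - {y})"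
          by auto
        then show ?thesis
        proof cases
          case 1
          then show ?thesis
            by (intro disjI1 exI[of _ X'] exI[of _ Y']) auto
        next
          case 2
          then show ?thesis
            using edges_remove_right[OF less.prems \<open>y \<in> Y\<close>] \<open>deg y X < b\<close> c by simp
        qed
      qed
    qed
  qed
  then show ?thesis
    using dense sparse by blast
qed

section \<open>Connection inside a vertex set\<close>

definition linked :: "'a set \<Rightarrow> 'a \<Rightarrow> 'a \<Rightarrow> bool" where
  "linked W x y \<longleftrightarrow> (\<exists>xs. is_path xs \<and> hd xs = x \<and> last xs = y \<and> set xs \<subseteq> W)"

lemma linked_refl: "x \<in> W \<Longrightarrow> linked W x x"
  unfolding linked_def by (intro exI[of _ "[x]"]) (auto simp: is_path_def)

lemma linked_step:
  assumes "linked W x y" "E y z" "z \<in> W"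
  shows "linked W x z"
proof -
  obtain xs where xs: "is_path xs" "hd xs = x" "last xs = y" "set xs \<subseteq> W"
    using assms(1) by (auto simp: linked_def)
  show ?thesis
  proof (cases "z \<in> set xs")
    case True
    then obtain ys zs where "xs = ys @ z # zs"
      by (meson split_list)
    then show ?thesis
      using xs unfolding linked_def is_path_def
      by (intro exI[of _ "ys @ [z]"]) (auto simp: successively_append_iff hd_append split: if_splits)
  next
    case False
    then show ?thesis
      using xs assms unfolding linked_def is_path_def
      by (intro exI[of _ "xs @ [z]"]) (auto simp: successively_append_iff)
  qed
qed

lemma linked_in: "linked W x y \<Longrightarrow> x \<in> W \<and> y \<in> W"
  unfolding linked_def is_path_def by (metis hd_in_set last_in_set subsetD)

text \<open>This is Mader's theorem on highly connected subgraphs: a smallest set \<open>D\<close> with at least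
  \<open>2 * q\<close> elements and \<open>edges D D > d * (card D - q)\<close> works. A separator of size at most \<open>q\<close> would
  split \<open>D\<close> into two overlapping smaller sets, one of which still satisfies the inequality.\<close>

lemma highly_connected_subset:
  assumes X: "finite X" "X \<noteq> {}" "\<And>x. x \<in> X \<Longrightarrow> d \<le> deg x X" and q: "4 * q \<le> d" "0 < q"
  obtains D where "D \<subseteq> X" "D \<noteq> {}" "\<And>x. x \<in> D \<Longrightarrow> d < 2 * deg x D"
    "\<And>S x y. \<lbrakk>finite S; card S \<le> q; x \<in> D - S; y \<in> D - S\<rbrakk> \<Longrightarrow> linked (D - S) x y"
proof -
  define P where "P D \<longleftrightarrow> D \<subseteq> X \<and> 2 * q \<le> card D \<and> d * (card D - q) < edges D D" for D
  obtain x0 where x0: "x0 \<in> X"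
    using X(2) by blast
  have dX: "d \<le> card X"
    using X(3)[OF x0] deg_le_card[OF X(1), of x0] by simp
  have "d * (card X - q) < d * card X"
    using dX q by simp
  also have "\<dots> \<le> edges X X"
    unfolding edges_def using sum_mono[of X "\<lambda>_. d" "\<lambda>x. deg x X"] X(3) by (simp add: mult.commute)
  finally have "P X"
    using q dX by (simp add: P_def)
  then obtain D where D: "P D" "\<And>D'. P D' \<Longrightarrow> card D \<le> card D'"
    using ex_has_least_nat[of P X card] by metis
  have DX: "D \<subseteq> X" and Dq: "2 * q \<le> card D" and De: "d * (card D - q) < edges D D"
    using D(1) by (auto simp: P_def)
  have fin: "finite D"
    using finite_subset[OF DX X(1)] .
  have small: "edges D' D' \<le> d * (card D' - q)" if "D' \<subset> D" "2 * q \<le> card D'" for D'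
    using D(2)[of D'] psubset_card_mono[OF fin that(1)] that DX by (force simp: P_def)
  \<comment> \<open>A set of \<open>2 * q\<close> vertices has at most \<open>4 * q * q\<close>
    ordered adjacent pairs, too few as \<open>4 * q \<le> d\<close>. So one vertex may be deleted
    and minimality still applies.\<close>
  have "card D \<noteq> 2 * q"
  proof
    assume c: "card D = 2 * q"
    have "edges D D \<le> (\<Sum>x\<in>D. 2 * q)"
      unfolding edges_def c[symmetric] by (intro sum_mono deg_le_card fin)
    also have "\<dots> = (4 * q) * q"
      by (simp add: c)
    also have "\<dots> \<le> d * (card D - q)"
      using q c by (intro mult_mono) auto
    finally show False
      using De by simp
  qed
  then have Dq: "2 * q < card D"
    using Dq by simp
  \<comment> \<open>By minimality \<open>D - {x}\<close> violates the inequality, so deleting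
    \<open>x\<close> loses more than \<open>d\<close> ordered pairs; each edge at \<open>x\<close>
    accounts for two.\<close>
  have min_deg: "d < 2 * deg x D" if x: "x \<in> D" for x
  proof -
    have c: "card D = Suc (card (D - {x}))"
      using card_Suc_Diff1[OF fin x] by simp
    have "2 * q \<le> card (D - {x})"
      using Dq c by linarith
    then have "edges (D - {x}) (D - {x}) \<le> d * (card (D - {x}) - q)"
      using x by (intro small) blast
    moreover have "edges D D = deg x D + edges (D - {x}) D"
      using edges_remove_left[OF fin x] .
    moreover have "edges (D - {x}) D = deg x (D - {x}) + edges (D - {x}) (D - {x})"
      using edges_remove_right[of "D - {x}" D x] fin x by simp
    moreover have "deg x (D - {x}) \<le> deg x D"
      by (rule deg_mono) auto
    moreover have "d * (card D - q) = d * (card (D - {x}) - q) + d"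
    proof -
      have "card D - q = Suc (card (D - {x}) - q)"
        using c Dq by simp
      then show ?thesis
        by simp
    qed
    ultimately show ?thesis
      using De by linarith
  qed
  moreover have "linked (D - S) x y"
    if S: "finite S" "card S \<le> q" and xy: "x \<in> D - S" "y \<in> D - S" for S x y
  proof (rule ccontr)
    assume not: "\<not> linked (D - S) x y"
    define X1 where "X1 = {z. linked (D - S) x z}"
    define X2 where "X2 = D - S - X1"
    define S' where "S' = D \<inter> S"
    have X1: "x \<in> X1" "X1 \<subseteq> D - S" and X2: "y \<in> X2"
      using xy not linked_in linked_refl by (auto simp: X1_def X2_def)
    have no_edge: "\<not> E u v" if "u \<in> X1" "v \<in> X2" for u v
      using linked_step that unfolding X1_def X2_def by blast
    have S': "card S' \<le> q"
      using S card_mono[of S S'] by (simp add: S'_def)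
    have fins: "finite X1" "finite X2" "finite S'"
      using X1(2) fin finite_subset[of _ D] by (auto simp: X2_def S'_def)
    have D_eq: "D = X1 \<union> X2 \<union> S'"
      using X1(2) by (auto simp: X2_def S'_def)
    have disj: "X1 \<inter> X2 = {}" "X1 \<inter> S' = {}" "X2 \<inter> S' = {}"
      using X1(2) by (auto simp: X2_def S'_def)
    have d1: "deg u D \<le> deg u (X1 \<union> S')" if "u \<in> X1" for u
      unfolding deg_def using no_edge[OF that] D_eq by (intro card_mono) (auto simp: nb_def fins)
    have d2: "deg u D \<le> deg u (X2 \<union> S')" if "u \<in> X2" for u
      unfolding deg_def using no_edge[OF _ that] D_eq E_commute
      by (intro card_mono) (auto simp: nb_def fins)
    \<comment> \<open>All neighbours of \<open>x\<close> in \<open>D\<close>, more than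
      \<open>d / 2 \<ge> 2 * q\<close>, lie on its side. This makes minimality applicable and the
      later subtractions exact.\<close>
    have c1: "2 * q \<le> card (X1 \<union> S')"
      using d1[OF X1(1)] deg_le_card[of "X1 \<union> S'" x] min_deg[of x] xy q fins by simp
    have c2: "2 * q \<le> card (X2 \<union> S')"
      using d2[OF X2] deg_le_card[of "X2 \<union> S'" y] min_deg[of y] xy q fins by simp
    have e1: "edges (X1 \<union> S') (X1 \<union> S') \<le> d * (card (X1 \<union> S') - q)"
      using D_eq X2 disj by (intro small c1) blast
    have e2: "edges (X2 \<union> S') (X2 \<union> S') \<le> d * (card (X2 \<union> S') - q)"
      using D_eq X1 disj by (intro small c2) blast
    have "edges D D = edges X1 D + edges X2 D + edges S' D"
      unfolding edges_def using fins disj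
      by (subst (1) D_eq) (simp add: sum.union_disjoint Int_Un_distrib2)
    also have "edges X1 D \<le> edges X1 (X1 \<union> S')"
      unfolding edges_def by (intro sum_mono d1)
    also have "edges X2 D \<le> edges X2 (X2 \<union> S')"
      unfolding edges_def by (intro sum_mono d2)
    also have "edges S' D \<le> edges S' (X1 \<union> S') + edges S' (X2 \<union> S')"
    proof -
      have "deg u D \<le> deg u (X1 \<union> S') + deg u (X2 \<union> S')" for u
        using deg_Un_le[of u "X1 \<union> S'" "X2 \<union> S'"] D_eq by (simp add: Un_ac)
      then show ?thesis
        unfolding edges_def sum.distrib[symmetric] by (intro sum_mono)
    qed
    also have "edges X1 (X1 \<union> S') + edges X2 (X2 \<union> S')
        + (edges S' (X1 \<union> S') + edges S' (X2 \<union> S'))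
        = edges (X1 \<union> S') (X1 \<union> S') + edges (X2 \<union> S') (X2 \<union> S')"
      unfolding edges_def using fins disj by (simp add: sum.union_disjoint)
    also have "\<dots> \<le> d * (card (X1 \<union> S') - q) + d * (card (X2 \<union> S') - q)"
      using e1 e2 by simp
    also have "\<dots> = d * ((card (X1 \<union> S') - q) + (card (X2 \<union> S') - q))"
      by (simp add: distrib_left)
    \<comment> \<open>Counting \<open>S'\<close> twice costs at most \<open>q\<close>, which the
      second subtraction of \<open>q\<close> pays for.\<close>
    also have "\<dots> \<le> d * (card D - q)"
    proof (rule mult_le_mono2)
      have "card D = card X1 + card X2 + card S'"
        using fins disj by (subst D_eq) (simp add: card_Un_disjoint Int_Un_distrib2)
      moreover have "card (X1 \<union> S') = card X1 + card S'" "card (X2 \<union> S') = card X2 + card S'"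
        using fins disj by (auto simp: card_Un_disjoint)
      ultimately show "(card (X1 \<union> S') - q) + (card (X2 \<union> S') - q) \<le> card D - q"
        using S' c1 c2 by linarith
    qed
    finally show False
      using De by simp
  qed
  moreover have "D \<noteq> {}"
    using Dq by auto
  ultimately show ?thesis
    using DX that by blast
qed

section \<open>Cycles longer than six times the independence number\<close>

lemma is_cycle_append:
  assumes "is_path P" "is_path Q" "set P \<inter> set Q = {}" "E (last P) (hd Q)" "E (last Q) (hd P)"
    "3 \<le> length P + length Q"
  shows "is_cycle (P @ Q)"
  using assms by (auto simp: is_path_def is_cycle_def successively_append_iff)

text \<open>Shorten \<open>B\<close> between its ends to at most \<open>2 * k\<close> vertices.
  Enough vertices with many neighbours in \<open>A\<close> are left over to bring this number back
  to exactly \<open>2 * k\<close>.\<close>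

lemma cycle_length_by_insertion:
  assumes cyc: "is_cycle (B @ A)" and B: "B \<noteq> []" and A: "3 \<le> length A"
    and high: "2 * k \<le> card {w \<in> set B. k < deg w (set A)}"
  shows "\<exists>ys. is_cycle ys \<and> length ys = length A + 2 * k"
proof -
  define H where "H = {w \<in> set B. k < deg w (set A)}"
  have "A \<noteq> []"
    using A by auto
  have paths: "is_path A" "is_path B" and disj: "set A \<inter> set B = {}"
    and ends: "E (last A) (hd B)" "E (last B) (hd A)"
    using cyc B \<open>A \<noteq> []\<close> by (auto simp: is_cycle_def is_path_def successively_append_iff)
  obtain P where P: "is_path P" "hd P = hd B" "last P = last B" "set P \<subseteq> set B" "length P \<le> 2 * k"
    using is_path_shorten[OF paths(2) order_refl] by blast
  have cyc': "is_cycle (P @ A)"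
    using P paths disj ends A by (intro is_cycle_append) auto
  have cP: "card (set P) = length P"
    using P(1) by (simp add: is_path_def distinct_card)
  have "2 * k - length P \<le> card (H - set P)"
    using diff_card_le_card_Diff[of "set P" H] high by (simp add: H_def cP)
  then obtain W where W: "W \<subseteq> H - set P" "card W = 2 * k - length P" "finite W"
    using obtain_subset_with_card_n by metis
  have "W \<inter> set (P @ A) = {}"
    using W(1) disj by (auto simp: H_def)
  moreover have "k < deg w (set (P @ A))" if "w \<in> W" for w
  proof -
    have "k < deg w (set A)"
      using that W(1) by (auto simp: H_def)
    also have "\<dots> \<le> deg w (set (P @ A))"
      by (rule deg_mono) auto
    finally show ?thesis .
  qed
  ultimately obtain ys where ys: "is_cycle ys" "set ys = W \<union> set (P @ A)"
    using is_cycle_insert_vertices[OF cyc' W(3)] by blast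
  have "length ys = card (W \<union> set (P @ A))"
    using ys by (metis distinct_card is_cycle_def)
  also have "\<dots> = card W + length (P @ A)"
    using W(3) \<open>W \<inter> set (P @ A) = {}\<close> cyc'
    by (subst card_Un_disjoint) (auto simp: is_cycle_def distinct_card simp del: set_append)
  also have "\<dots> = length A + 2 * k"
    using W(2) P(5) by simp
  finally show ?thesis
    using ys(1) by blast
qed

text \<open>The new cycle is a flexible chain from \<open>x\<close> to \<open>p\<close> in
  \<open>D\<close>, a link from \<open>p\<close> to \<open>y\<close> in \<open>D\<close>, and the
  old cycle from \<open>y\<close> around to \<open>x\<close>. As \<open>x\<close> is first and
  \<open>y\<close> last, the retained arc between them avoids \<open>D\<close>.\<close>

lemma cycle_length_by_chain:
  assumes cyc: "is_cycle (B @ A)" and A: "A \<noteq> []"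
    and l: "6 * k + 1 \<le> l" "l \<le> length A + 2 * k"
    and L: "L \<subseteq> set B" "L \<noteq> {}" "\<And>w. w \<in> L \<Longrightarrow> 597 * k \<le> deg w L"
  shows "\<exists>ys. is_cycle ys \<and> length ys = l"
proof -
  have "finite L"
    using finite_subset[OF L(1)] by simp
  \<comment> \<open>A chain of \<open>2 * k\<close> triangles occupies up to
    \<open>6 * k + 1\<close> vertices, whose removal must not separate \<open>D\<close>.\<close>
  moreover have "4 * (6 * k + 1) \<le> 597 * k"
    using k_pos by simp
  ultimately obtain D where D: "D \<subseteq> L" "D \<noteq> {}" and deg_D: "\<And>x. x \<in> D \<Longrightarrow> 597 * k < 2 * deg x D"
    and link: "\<And>S x y. \<lbrakk>finite S; card S \<le> 6 * k + 1; x \<in> D - S; y \<in> D - S\<rbrakk> \<Longrightarrow> linked (D - S) x y"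
    using highly_connected_subset[of L "597 * k" "6 * k + 1"] L by auto
  have DB: "D \<subseteq> set B"
    using D L by auto
  then have "\<exists>x\<in>set B. x \<in> D"
    using D(2) by blast
  then obtain B1 x B2 where B: "B = B1 @ x # B2" and x: "x \<in> D" and B1: "\<forall>z\<in>set B1. z \<notin> D"
    by (rule split_list_first_propE)
  \<comment> \<open>A neighbour of \<open>x\<close> in \<open>D\<close> comes later on
    \<open>B\<close>, so \<open>y\<close> can be chosen different from \<open>x\<close>.\<close>
  have "deg x D \<noteq> 0"
    using deg_D[OF x] by auto
  then obtain x' where "x' \<in> D" "E x x'"
    unfolding deg_def nb_def by (metis (no_types, lifting) Collect_empty_eq card.empty)
  then have "x' \<in> set B2"
    using DB B B1 irrefl by auto
  then have "\<exists>y\<in>set B2. y \<in> D"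
    using \<open>x' \<in> D\<close> by blast
  then obtain B3 y B4 where B2: "B2 = B3 @ y # B4" and y: "y \<in> D" and B4: "\<forall>z\<in>set B4. z \<notin> D"
    by (rule split_list_last_propE)
  have dist: "distinct (B @ A)" and succ: "successively E (B @ A)" and close: "E (last A) (hd B)"
    using cyc A B by (simp_all add: is_cycle_def hd_append split: if_splits)
  have "x \<noteq> y"
    using dist B B2 by auto
  have "k + 3 * (2 * k) \<le> deg w D" "3 * (2 * k) + 1 \<le> deg w D" if "w \<in> D" for w
    using deg_D[OF that] k_pos by auto
  then obtain p U where U: "p \<in> D" "p \<in> U" "x \<in> U" "U \<subseteq> D \<union> D" "y \<notin> U" "finite U"
      "card U \<le> 3 * (2 * k) + 1" "2 * k = 0 \<or> p \<noteq> x"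
    and chain: "\<forall>m\<in>{2 * (2 * k) + 1..3 * (2 * k) + 1}.
      \<exists>xs. is_path xs \<and> hd xs = x \<and> last xs = p \<and> set xs \<subseteq> U \<and> length xs = m"
    by (rule flexible_chain[OF x \<open>x \<noteq> y\<close>])
  have "card (U - {p}) \<le> 6 * k + 1"
    using U by (simp add: card_Diff_singleton)
  then have "linked (D - (U - {p})) p y"
    using U y by (intro link) auto
  then obtain R where R: "is_path R" "hd R = p" "last R = y" "set R \<subseteq> D - (U - {p})"
    by (auto simp: linked_def)
  define R' where "R' = tl R"
  have R_eq: "R = p # R'"
    using R(1,2) by (auto simp: is_path_def R'_def)
  have "p \<noteq> y"
    using U by auto
  then have R': "R' \<noteq> []" "last R' = y"
    using R(3) R_eq by auto
  \<comment> \<open>All of the new cycle strictly between \<open>p\<close> and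
    \<open>x\<close>.\<close>
  define Q where "Q = R' @ B4 @ A @ B1"
  have "successively E ((y # B4 @ A) @ (B1 @ [x]))"
    using succ close A unfolding B B2
    by (auto simp: successively_append_iff successively_Cons hd_append)
  then have "successively E ((p # R') @ (B4 @ A @ B1 @ [x]))"
    using R(1) R' unfolding R_eq is_path_def
    by (subst successively_append_iff) (auto simp: successively_Cons hd_append)
  then have "successively E (p # Q @ [x])"
    by (simp add: Q_def)
  moreover have Q_nonempty: "Q \<noteq> []"
    using R' by (simp add: Q_def)
  ultimately have Q: "successively E Q" "E p (hd Q)" "E (last Q) x"
    using R'(1) by (auto simp: successively_Cons successively_append_iff Q_nonempty)
  have Q_U: "set Q \<inter> U = {}"
    using R R_eq B1 B4 U(4) DB dist by (auto simp: Q_def is_path_def)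
  have "distinct Q"
    using R R_eq B1 B4 DB dist unfolding Q_def B B2 is_path_def by auto
  then have "is_path Q"
    using Q(1) R' by (simp add: is_path_def Q_def)
  \<comment> \<open>Shortening \<open>Q\<close> to less than \<open>2 * k\<close> below this target
    leaves the chain a length between \<open>4 * k + 1\<close> and \<open>6 * k\<close>.\<close>
  moreover have "2 * k \<le> l - 4 * k - 1"
    using l by simp
  ultimately obtain Q' where Q': "is_path Q'" "hd Q' = hd Q" "last Q' = last Q" "set Q' \<subseteq> set Q"
    "length Q' \<le> l - 4 * k - 1" "length Q < l - 4 * k - 1 \<or> l - 4 * k - 1 < length Q' + 2 * k"
    by (rule is_path_shorten)
  \<comment> \<open>\<open>A\<close> alone supplies this many vertices, so \<open>Q\<close> is not
    too short to begin with.\<close>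
  have "l - 4 * k - 1 \<le> length Q"
    using l by (simp add: Q_def)
  then have "l - length Q' \<in> {2 * (2 * k) + 1..3 * (2 * k) + 1}"
    using Q'(5,6) l by auto
  then obtain C where C: "is_path C" "hd C = x" "last C = p" "set C \<subseteq> U" "length C = l - length Q'"
    using chain by blast
  have "is_cycle (C @ Q')"
    using C Q' Q Q_U l k_pos by (intro is_cycle_append) auto
  moreover have "length (C @ Q') = l"
    using C Q'(5) by simp
  ultimately show ?thesis
    by blast
qed

lemma long_cycles:
  assumes ham: "is_cycle zs" "set zs = V" and min_deg: "\<And>v. v \<in> V \<Longrightarrow> 600 * k \<le> deg v V"
    and l: "6 * k + 1 \<le> l" "l \<le> card V"
  shows "\<exists>ys. is_cycle ys \<and> length ys = l"
proof (cases "l = card V")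
  case True
  then show ?thesis
    using ham by (metis distinct_card is_cycle_def)
next
  case False
  define n where "n = card V"
  have n: "length zs = n" "l < n"
    using ham False l by (auto simp: is_cycle_def distinct_card[symmetric] n_def)
  define A where "A = drop (n - (l - 2 * k)) zs"
  define B where "B = take (n - (l - 2 * k)) zs"
  have zs: "zs = B @ A"
    by (simp add: A_def B_def)
  have lenA: "length A = l - 2 * k" and lenB: "2 * k < length B"
    using n l by (auto simp: A_def B_def)
  have V: "V = set A \<union> set B"
    using ham zs by auto
  define H where "H = {w \<in> set B. k < deg w (set A)}"
  show ?thesis
  proof (cases "2 * k \<le> card H")
    case True
    then show ?thesis
      using cycle_length_by_insertion[of B A] ham zs lenA lenB l k_pos by (fastforce simp: H_def)
  next
    case False
    define L where "L = set B - H"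
    have "card (set B) = length B"
      using ham zs by (auto simp: is_cycle_def distinct_card)
    then have "card H < card (set B)"
      using False lenB by simp
    moreover have "finite H"
      by (simp add: H_def)
    ultimately have "\<not> set B \<subseteq> H"
      using card_mono[of H "set B"] by linarith
    then have "L \<noteq> {}"
      by (auto simp: L_def)
    \<comment> \<open>Outside \<open>L\<close> there are at most \<open>k\<close> neighbours in
      \<open>A\<close> and fewer than \<open>2 * k\<close> in \<open>H\<close>.\<close>
    moreover have "597 * k \<le> deg w L" if "w \<in> L" for w
    proof -
      have "600 * k \<le> deg w V"
        using that V by (intro min_deg) (auto simp: L_def)
      also have "V = (set A \<union> H) \<union> L"
        using V by (auto simp: L_def H_def)
      also have "deg w \<dots> \<le> deg w (set A) + deg w H + deg w L"
        using deg_Un_le[of w "set A \<union> H" L] deg_Un_le[of w "set A" H] by simp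
      also have "deg w (set A) \<le> k"
        using that by (auto simp: L_def H_def)
      also have "deg w H \<le> 2 * k"
        using deg_le_card[of H w] False by (simp add: H_def)
      finally show ?thesis
        by simp
    qed
    moreover have "A \<noteq> []" "l \<le> length A + 2 * k"
      using lenA l k_pos by auto
    ultimately show ?thesis
      using cycle_length_by_chain[of B A l L] ham(1) zs l by (auto simp: L_def)
  qed
qed

section \<open>Breadth-first layers and short cycles\<close>

primrec ball :: "'a \<Rightarrow> nat \<Rightarrow> 'a set" where
  "ball r 0 = {r}"
| "ball r (Suc i) = ball r i \<union> {v. \<exists>u\<in>ball r i. E u v}"

text \<open>The vertices at distance exactly \<open>i\<close> from \<open>r\<close>, where
  \<open>ball\<close> collects distance at most \<open>i\<close>.\<close>

primrec layer :: "'a \<Rightarrow> nat \<Rightarrow> 'a set" where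
  "layer r 0 = {r}"
| "layer r (Suc i) = ball r (Suc i) - ball r i"

lemma root_in_ball: "r \<in> ball r i"
  by (induction i) auto

lemma layer_subset_ball: "layer r i \<subseteq> ball r i"
  by (cases i) auto

lemma layer_Suc_V: "layer r (Suc i) \<subseteq> V"
proof -
  have "ball r i \<subseteq> insert r V" for i
    by (induction i) (auto intro: E_in_V2)
  from this[of "Suc i"] show ?thesis
    using root_in_ball[of r i] by auto
qed

lemma finite_layer [simp]: "finite (layer r i)"
  using layer_Suc_V finite_subset[OF _ finite_V] by (cases i) (auto simp del: layer.simps(2))

lemma layer_parent:
  assumes "v \<in> layer r (Suc i)"
  obtains u where "u \<in> layer r i" "E u v"
proof -
  obtain u where u: "u \<in> ball r i" "E u v"
    using assms by auto
  have "u \<in> layer r i"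
    using assms u by (cases i) auto
  then show ?thesis
    using that u by blast
qed

lemma layer_neighbour:
  assumes "u \<in> layer r (Suc i)" "E u v"
  shows "v \<in> layer r i \<union> (layer r (Suc i) \<union> layer r (Suc (Suc i)))"
proof (cases "v \<in> ball r i")
  case False
  then show ?thesis
    using assms by auto
next
  case True
  show ?thesis
  proof (cases i)
    case 0
    then show ?thesis
      using True by simp
  next
    case (Suc j)
    have "u \<notin> ball r (Suc j)"
      using assms(1) Suc by simp
    then have "v \<notin> ball r j"
      using sym[OF assms(2)] by auto
    then show ?thesis
      using True Suc by simp
  qed
qed

text \<open>Climb from \<open>p\<close> and \<open>q\<close> to parents simultaneously until the
  climbs meet. They are equally long, so the number of vertices passed is odd.\<close>

lemma path_through_ball:
  assumes "p \<in> layer r (Suc i)" "q \<in> layer r (Suc i)" "p \<noteq> q"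
  shows "\<exists>h zs. h \<le> i \<and> is_path zs \<and> length zs = 2 * h + 1 \<and> set zs \<subseteq> ball r i \<and>
    E p (hd zs) \<and> E (last zs) q"
  using assms
proof (induction i arbitrary: p q)
  case 0
  then have "E r p" "E r q"
    by auto
  then show ?case
    by (intro exI[of _ 0] exI[of _ "[r]"]) (auto simp: is_path_def sym)
next
  case (Suc i)
  obtain p' q' where p': "p' \<in> layer r (Suc i)" "E p' p" and q': "q' \<in> layer r (Suc i)" "E q' q"
    using Suc.prems layer_parent by metis
  have in_ball: "p' \<in> ball r (Suc i)" "q' \<in> ball r (Suc i)"
    using p' q' layer_subset_ball by blast+
  show ?case
  proof (cases "p' = q'")
    case True
    then show ?thesis
      using p' q' in_ball by (intro exI[of _ 0] exI[of _ "[p']"]) (auto simp: is_path_def sym)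
  next
    case False
    then obtain h zs where zs: "h \<le> i" "is_path zs" "length zs = 2 * h + 1" "set zs \<subseteq> ball r i"
        "E p' (hd zs)" "E (last zs) q'"
      using Suc.IH p'(1) q'(1) by blast
    have "p' \<notin> ball r i" "q' \<notin> ball r i"
      using p' q' by auto
    then have "is_path (p' # zs @ [q'])"
      using zs False by (auto simp: is_path_def successively_Cons successively_append_iff hd_append)
    moreover have "set (p' # zs @ [q']) \<subseteq> ball r (Suc i)"
      using zs(4) in_ball by auto
    ultimately show ?thesis
      using zs p' q' by (intro exI[of _ "Suc h"] exI[of _ "p' # zs @ [q']"]) (auto simp: sym)
  qed
qed

text \<open>The ends of the chain are joined through the breadth-first tree by a path of unknown even
  length \<open>2 * h + 2\<close> with \<open>h \<le> i\<close>; the bounds on \<open>l\<close> leave room for every such \<open>h\<close>.\<close>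

lemma cycle_in_dense_layers:
  assumes XY: "X \<subseteq> layer r (Suc i)" "Y \<subseteq> layer r (Suc i) \<union> layer r (Suc (Suc i))" "X \<noteq> {}"
    and X: "\<And>x. x \<in> X \<Longrightarrow> k + 3 * t \<le> deg x Y"
    and Y: "\<And>y. y \<in> Y \<Longrightarrow> 3 * t + 1 \<le> deg y X"
    and t: "0 < t" "2 * t + 2 * i + 2 \<le> l" "l \<le> 3 * t + 2"
  shows "\<exists>ys. is_cycle ys \<and> length ys = l"
proof -
  obtain x where x: "x \<in> X"
    using XY(3) by blast
  have off_ball: "(X \<union> Y) \<inter> ball r i = {}"
    using XY(1,2) by auto
  \<comment> \<open>The chain lemma takes a vertex to avoid; the root, which is not in
    \<open>X \<union> Y\<close>, fills that place.\<close>
  then have "x \<noteq> r"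
    using x root_in_ball[of r i] by auto
  then obtain p U where p: "p \<in> X" "U \<subseteq> X \<union> Y" "t = 0 \<or> p \<noteq> x"
    and chain: "\<forall>m\<in>{2 * t + 1..3 * t + 1}.
      \<exists>xs. is_path xs \<and> hd xs = x \<and> last xs = p \<and> set xs \<subseteq> U \<and> length xs = m"
    using flexible_chain[OF x _ X Y, of r] by metis
  obtain h zs where zs: "h \<le> i" "is_path zs" "length zs = 2 * h + 1" "set zs \<subseteq> ball r i"
      "E p (hd zs)" "E (last zs) x"
    using path_through_ball[of p r i x] p(1,3) x XY(1) t(1) by blast
  \<comment> \<open>The lower end uses \<open>h \<le> i\<close>, the upper end
    \<open>l \<le> 3 * t + 2\<close>.\<close>
  have "l - (2 * h + 1) \<in> {2 * t + 1..3 * t + 1}"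
    using t zs(1) by auto
  then obtain xs where xs: "is_path xs" "hd xs = x" "last xs = p" "set xs \<subseteq> U" "length xs = l - (2 * h + 1)"
    using chain by blast
  have "is_cycle (xs @ zs)"
    using xs zs p(2) off_ball t by (intro is_cycle_append) auto
  moreover have "length (xs @ zs) = l"
    using xs zs t by auto
  ultimately show ?thesis
    by blast
qed

section \<open>Growth of the layers when the length \<open>l\<close> is missing\<close>

lemma layer_edges_bound:
  assumes no_cycle: "\<not> (\<exists>ys. is_cycle ys \<and> length ys = l)"
    and t: "0 < t" "2 * t + 2 * i + 2 \<le> l" "l \<le> 3 * t + 2"
  shows "edges (layer r (Suc i)) (layer r (Suc i) \<union> layer r (Suc (Suc i)))
      \<le> (k + 3 * t) * card (layer r (Suc i))
        + (3 * t + 1) * (card (layer r (Suc i)) + card (layer r (Suc (Suc i))))"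
proof -
  have "finite (layer r (Suc i))" "finite (layer r (Suc i) \<union> layer r (Suc (Suc i)))"
    using finite_layer by blast+
  then show ?thesis
  proof (cases rule: dense_pair_or_few_edges[of _ _ "k + 3 * t" "3 * t + 1"])
    case (dense X Y)
    then show ?thesis
      using cycle_in_dense_layers[OF dense(1-5) t] no_cycle by blast
  next
    case sparse
    have "(3 * t + 1) * card (layer r (Suc i) \<union> layer r (Suc (Suc i)))
        \<le> (3 * t + 1) * (card (layer r (Suc i)) + card (layer r (Suc (Suc i))))"
      by (intro mult_le_mono2 card_Un_le)
    with sparse show ?thesis
      by linarith
  qed
qed

text \<open>A larger layer contains a set of minimum degree \<open>k + 3 * t\<close>, which forms a
  dense pair with itself.\<close>

lemma layer_card_bound:
  assumes no_cycle: "\<not> (\<exists>ys. is_cycle ys \<and> length ys = l)"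
    and t: "0 < t" "2 * t + 2 * i + 2 \<le> l" "l \<le> 3 * t + 2"
  shows "card (layer r (Suc i)) \<le> k * (k + 3 * t)"
proof (rule ccontr)
  assume "\<not> ?thesis"
  then have "k * (k + 3 * t) < card (layer r (Suc i))"
    by simp
  then obtain X where X: "X \<subseteq> layer r (Suc i)" "X \<noteq> {}" "\<And>x. x \<in> X \<Longrightarrow> k + 3 * t \<le> deg x X"
    by (rule exists_min_degree_subset[OF layer_Suc_V]) blast
  have "3 * t + 1 \<le> deg x X" if "x \<in> X" for x
    using X(3)[OF that] k_pos by simp
  then have "\<exists>ys. is_cycle ys \<and> length ys = l"
    using X by (intro cycle_in_dense_layers[of X r i X, OF _ _ _ _ _ t]) auto
  then show False
    using no_cycle by blast
qed

lemma layer_degree_sum: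
  assumes min_deg: "\<And>v. v \<in> V \<Longrightarrow> d \<le> deg v V"
  shows "d * card (layer r (Suc i)) \<le> edges (layer r i) (layer r (Suc i))
    + edges (layer r (Suc i)) (layer r (Suc i) \<union> layer r (Suc (Suc i)))"
proof -
  have "d \<le> deg v (layer r i) + deg v (layer r (Suc i) \<union> layer r (Suc (Suc i)))"
    if v: "v \<in> layer r (Suc i)" for v
  proof -
    have "d \<le> deg v V"
      using v layer_Suc_V by (intro min_deg) blast
    also have "\<dots> \<le> deg v (layer r i \<union> (layer r (Suc i) \<union> layer r (Suc (Suc i))))"
      unfolding deg_def
    proof (rule card_mono[OF finite_nb])
      show "nb v V \<subseteq> nb v (layer r i \<union> (layer r (Suc i) \<union> layer r (Suc (Suc i))))"
        using layer_neighbour[OF v] unfolding nb_def by blast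
    qed
    also have "\<dots> \<le> deg v (layer r i) + deg v (layer r (Suc i) \<union> layer r (Suc (Suc i)))"
      by (rule deg_Un_le)
    finally show ?thesis .
  qed
  then have "(\<Sum>v\<in>layer r (Suc i). d) \<le> edges (layer r (Suc i)) (layer r i)
    + edges (layer r (Suc i)) (layer r (Suc i) \<union> layer r (Suc (Suc i)))"
    unfolding edges_def sum.distrib[symmetric] by (rule sum_mono)
  moreover have "edges (layer r (Suc i)) (layer r i) = edges (layer r i) (layer r (Suc i))"
    by (intro edges_commute finite_layer)
  ultimately show ?thesis
    by (simp add: mult.commute)
qed

text \<open>For \<open>x\<close>, \<open>y\<close>, \<open>z\<close> the sizes of consecutive layers
  and \<open>e\<close>, \<open>f\<close> the edge counts of \<open>layer_degree_sum\<close>: five of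
  the six products are at most \<open>7 * k * y\<close>, so \<open>b * z\<close> must carry the
  remaining \<open>565 * k * y\<close>.\<close>

lemma growth_arithmetic:
  fixes x y z a b e f :: nat
  assumes "600 * k * y \<le> e + f" "e \<le> a * x + b * (x + y)" "f \<le> a * y + b * (y + z)" "x \<le> y"
    and ab: "a \<le> 7 * k" "b \<le> 7 * k"
  shows "500 * (k * y) \<le> b * z" "62 * y \<le> z"
proof -
  have "a * x \<le> 7 * k * y" "b * x \<le> 7 * k * y" "a * y \<le> 7 * k * y" "b * y \<le> 7 * k * y"
    by (intro mult_le_mono ab assms(4) order_refl)+
  then show *: "500 * (k * y) \<le> b * z"
    using assms(1-3) unfolding distrib_left by linarith
  have "b * z \<le> 7 * k * z"
    by (intro mult_le_mono ab order_refl)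
  then have "500 * (k * y) \<le> 7 * (k * z)"
    using * by linarith
  then have "500 * y \<le> 7 * z"
    using k_pos by simp
  then show "62 * y \<le> z"
    by linarith
qed

lemma layer_growth:
  assumes no_cycle: "\<not> (\<exists>ys. is_cycle ys \<and> length ys = l)"
    and min_deg: "\<And>v. v \<in> V \<Longrightarrow> 600 * k \<le> deg v V"
    and t: "0 < t" "2 * t + 2 * i + 2 \<le> l" "l \<le> 3 * t + 2" "t \<le> 2 * k"
  shows "500 * (k * card (layer r (Suc i))) \<le> (3 * t + 1) * card (layer r (Suc (Suc i)))
    \<and> 62 * card (layer r (Suc i)) \<le> card (layer r (Suc (Suc i)))"
  using t(2)
proof (induction i)
  case 0
  \<comment> \<open>The root sends at most one edge to each vertex of layer 1; the arithmetic is
    then applied with \<open>x = y\<close>.\<close>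
  have "edges (layer r 0) (layer r (Suc 0)) \<le> card (layer r (Suc 0))"
    using deg_le_card[OF finite_layer, of r r "Suc 0"] by (simp add: edges_def del: layer.simps(2))
  also have "\<dots> \<le> (k + 3 * t) * card (layer r (Suc 0)) + (3 * t + 1) * (card (layer r (Suc 0)) + card (layer r (Suc 0)))"
    by simp
  finally show ?case
    using growth_arithmetic[OF layer_degree_sum[OF min_deg, of r 0] _
        layer_edges_bound[OF no_cycle t(1) 0 t(3), of r] order_refl] t(4) k_pos
    by linarith
next
  case (Suc i)
  have i: "2 * t + 2 * i + 2 \<le> l"
    using Suc.prems by simp
  \<comment> \<open>The edges going back are covered by the bound for the previous layer, and the
    induction hypothesis supplies \<open>x \<le> y\<close>.\<close>
  have "edges (layer r (Suc i)) (layer r (Suc (Suc i)))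
      \<le> edges (layer r (Suc i)) (layer r (Suc i) \<union> layer r (Suc (Suc i)))"
    by (intro edges_mono finite_layer) auto
  also note layer_edges_bound[OF no_cycle t(1) i t(3)]
  finally have *: "edges (layer r (Suc i)) (layer r (Suc (Suc i)))
      \<le> (k + 3 * t) * card (layer r (Suc i))
        + (3 * t + 1) * (card (layer r (Suc i)) + card (layer r (Suc (Suc i))))" .
  have "card (layer r (Suc i)) \<le> card (layer r (Suc (Suc i)))"
    using Suc.IH[OF i] by linarith
  then show ?case
    using growth_arithmetic[OF layer_degree_sum[OF min_deg, of r "Suc i"] *
        layer_edges_bound[OF no_cycle t(1) Suc.prems t(3)]] t(4) k_pos
    by linarith
qed

text \<open>The neighbours of \<open>r\<close> contain a set of minimum degree 599, hence a path on
  \<open>l - 1\<close> vertices, which \<open>r\<close> closes to a cycle.\<close>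

lemma cycle_through_neighbourhood:
  assumes r: "r \<in> V" "600 * k \<le> deg r V" and l: "3 \<le> l" "l \<le> 600"
  shows "\<exists>ys. is_cycle ys \<and> length ys = l"
proof -
  have "k * 599 < card (nb r V)"
    using r(2) k_pos unfolding deg_def by linarith
  then obtain X where X: "X \<subseteq> nb r V" "X \<noteq> {}" "\<And>x. x \<in> X \<Longrightarrow> 599 \<le> deg x X"
    by (rule exists_min_degree_subset[OF nb_subset]) blast
  have "1 \<le> l - 1" "l - 1 \<le> 599 + 1"
    using l by auto
  then obtain xs where xs: "is_path xs" "set xs \<subseteq> X" "length xs = l - 1"
    using is_path_in_min_degree[OF X(2,3)] by metis
  have "set xs \<subseteq> nb r V" "xs \<noteq> []"
    using xs X(1) by (auto simp: is_path_def)
  then have "hd xs \<in> nb r V" "last xs \<in> nb r V" "r \<notin> set xs"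
    using irrefl by (auto simp: nb_def dest: hd_in_set last_in_set)
  then have "is_cycle ([r] @ xs)"
    using xs l sym by (intro is_cycle_append) (auto simp: is_path_def nb_def)
  then show ?thesis
    using xs l by (intro exI[of _ "[r] @ xs"]) auto
qed

lemma short_cycles:
  assumes V: "V \<noteq> {}" and min_deg: "\<And>v. v \<in> V \<Longrightarrow> 600 * k \<le> deg v V"
    and l: "3 \<le> l" "l \<le> 6 * k"
  shows "\<exists>ys. is_cycle ys \<and> length ys = l"
proof (rule ccontr)
  assume no_cycle: "\<not> ?thesis"
  obtain r where r: "r \<in> V"
    using V by blast
  \<comment> \<open>Lengths up to 600 are settled; 12 already makes the subtraction in
    \<open>n\<close> exact.\<close>
  have "12 \<le> l"
    using cycle_through_neighbourhood[OF r min_deg[OF r] l(1)] no_cycle by force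
  define t where "t = l div 3"
  define n where "n = l div 6 - 2"
  have n: "Suc (Suc n) = l div 6"
    using \<open>12 \<le> l\<close> by (simp add: n_def)
  have t: "0 < t" "l \<le> 3 * t + 2" "t \<le> 2 * k" "3 * t \<le> l"
    using \<open>12 \<le> l\<close> l by (auto simp: t_def)
  \<comment> \<open>Holds because \<open>2 * (l div 3) + 2 * (l div 6) \<le> l\<close>.\<close>
  have depth: "2 * t + 2 * i + 2 \<le> l" if "Suc i \<le> Suc (Suc n)" for i
    using that unfolding n t_def by linarith
  have x1: "600 * k \<le> card (layer r (Suc 0))"
  proof -
    have "nb r V \<subseteq> layer r (Suc 0)"
      using irrefl by (auto simp: nb_def)
    then show ?thesis
      using card_mono[OF finite_layer, of "nb r V" r "Suc 0"] min_deg[OF r] by (simp add: deg_def)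
  qed
  \<comment> \<open>The constant is \<open>500 * 600\<close>. Growth linear in \<open>j\<close> is
    enough, so the factor 62 only has to lift \<open>Suc j\<close> to
    \<open>Suc (Suc j)\<close>.\<close>
  have grow: "Suc j * (300000 * (k * k)) \<le> (3 * t + 1) * card (layer r (Suc (Suc j)))"
    if "j \<le> n" for j
    using that
  proof (induction j)
    case 0
    have "500 * (k * (600 * k)) \<le> 500 * (k * card (layer r (Suc 0)))"
      using x1 by (intro mult_le_mono2)
    also have "\<dots> \<le> (3 * t + 1) * card (layer r (Suc (Suc 0)))"
      using layer_growth[OF no_cycle min_deg t(1) depth t(2,3), of 0 r] by simp
    finally show ?case
      by simp
  next
    case (Suc j)
    let ?x = "card (layer r (Suc (Suc j)))" and ?y = "card (layer r (Suc (Suc (Suc j))))"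
    have "Suc (Suc j) * (300000 * (k * k)) \<le> 62 * (Suc j * (300000 * (k * k)))"
      by simp
    also have "\<dots> \<le> 62 * ((3 * t + 1) * ?x)"
      using Suc by (intro mult_le_mono2) auto
    also have "\<dots> = (3 * t + 1) * (62 * ?x)"
      by simp
    also have "\<dots> \<le> (3 * t + 1) * ?y"
      using layer_growth[OF no_cycle min_deg t(1) depth t(2,3), of "Suc j" r] Suc.prems
      by (intro mult_le_mono2) simp
    finally show ?case .
  qed
  have "Suc n * (300000 * (k * k)) \<le> (3 * t + 1) * card (layer r (Suc (Suc n)))"
    by (rule grow) simp
  also have "\<dots> \<le> (3 * t + 1) * (k * (k + 3 * t))"
    by (intro mult_le_mono2 layer_card_bound[OF no_cycle t(1) depth t(2)]) simp
  also have "\<dots> \<le> (3 * t + 1) * (k * (7 * k))"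
    using t(3) by (intro mult_le_mono2) simp
  finally have "(k * k) * (Suc n * 300000) \<le> (k * k) * ((3 * t + 1) * 7)"
    by (simp only: ac_simps)
  moreover have "0 < k * k"
    using k_pos by simp
  \<comment> \<open>Absurd: from \<open>3 * t \<le> l \<le> 6 * n + 17\<close> the right side is at
    most \<open>126 * Suc n\<close>.\<close>
  ultimately have "Suc n * 300000 \<le> (3 * t + 1) * 7"
    by (metis nat_mult_le_cancel1)
  moreover have "l \<le> 6 * Suc (Suc n) + 5"
    unfolding n by linarith
  ultimately show False
    using t(4) by simp
qed

lemma all_cycle_lengths:
  assumes "is_cycle zs" "set zs = V" "\<And>v. v \<in> V \<Longrightarrow> 600 * k \<le> deg v V" "3 \<le> l" "l \<le> card V"
  shows "\<exists>ys. is_cycle ys \<and> length ys = l"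
proof (cases "l \<le> 6 * k")
  case True
  have "V \<noteq> {}"
    using assms(4,5) by auto
  then show ?thesis
    using short_cycles assms(3,4) True by blast
next
  case False
  then show ?thesis
    using long_cycles assms by auto
qed

section \<open>Hamiltonicity of highly connected graphs\<close>

lemma successively_linked:
  assumes "linked W x (hd ys)" "ys \<noteq> []" "successively E ys" "set ys \<subseteq> W"
  shows "linked W x (last ys)"
  using assms(2-) assms(1)
proof (induction ys rule: rev_nonempty_induct)
  case (snoc y ys)
  then show ?case
    by (auto simp: successively_append_iff hd_append intro: linked_step)
qed auto

lemma linked_sym: "linked W x y \<Longrightarrow> linked W y x"
  unfolding linked_def is_path_def
  by (metis distinct_rev hd_rev last_rev rev_is_Nil_conv set_rev successively_converse_E successively_rev)

lemma linked_trans: "linked W x y \<Longrightarrow> linked W y z \<Longrightarrow> linked W x z"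
  unfolding linked_def[of W y z] is_path_def using successively_linked by blast

lemma linked_closed:
  assumes "linked W x y" "x \<in> F" "\<And>u v. \<lbrakk>u \<in> F; E u v; v \<in> W\<rbrakk> \<Longrightarrow> v \<in> F"
  shows "y \<in> F"
proof -
  have "successively E ys \<Longrightarrow> ys \<noteq> [] \<Longrightarrow> hd ys \<in> F \<Longrightarrow> set ys \<subseteq> W \<Longrightarrow> last ys \<in> F" for ys
  proof (induction ys rule: rev_induct)
    case (snoc y ys)
    then show ?case
      using assms(3) by (cases "ys = []") (auto simp: successively_append_iff)
  qed auto
  then show ?thesis
    using assms(1,2) unfolding linked_def is_path_def by blast
qed

text \<open>Take a longest cycle, a vertex \<open>w\<close> off it, the component \<open>F\<close>
  of \<open>w\<close> off the cycle and its attachments \<open>N\<close>. There are at most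
  \<open>k\<close> attachments and they miss a cycle vertex, which \<open>N\<close> then separates
  from \<open>w\<close>.\<close>

lemma chvatal_erdos:
  assumes cyc: "is_cycle ys"
    and conn: "\<And>S x y. \<lbrakk>S \<subseteq> V; card S \<le> k; x \<in> V - S; y \<in> V - S\<rbrakk> \<Longrightarrow> linked (V - S) x y"
  shows "\<exists>zs. is_cycle zs \<and> set zs = V"
proof -
  have "length zs \<le> card V" if "is_cycle zs" for zs
    using that is_cycle_subset_V[OF that] card_mono[OF finite_V]
    by (metis distinct_card is_cycle_def)
  then have "\<exists>zs. is_cycle zs \<and> (\<forall>zs'. is_cycle zs' \<longrightarrow> length zs' \<le> length zs)"
    using ex_has_greatest_nat[of is_cycle ys length "Suc (card V)"] cyc by (simp add: less_Suc_eq_le)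
  then obtain zs where zs: "is_cycle zs" and longest: "\<And>zs'. is_cycle zs' \<Longrightarrow> length zs' \<le> length zs"
    by metis
  have "V \<subseteq> set zs"
  proof
    fix w assume w: "w \<in> V"
    show "w \<in> set zs"
    proof (rule ccontr)
      assume w': "w \<notin> set zs"
      define F where "F = {v. linked (V - set zs) w v}"
      define N where "N = {v \<in> set zs. \<exists>f\<in>F. E v f}"
      have F: "w \<in> F" "F \<subseteq> V - set zs"
        using w w' linked_refl by (auto simp: F_def dest: linked_in)
      have ear: "\<exists>Q. is_path Q \<and> set Q \<inter> set zs = {} \<and> E u (hd Q) \<and> E (last Q) v"
        if "u \<in> N" "v \<in> N" for u v
      proof -
        obtain f g where "f \<in> F" "E u f" "g \<in> F" "E v g"
          using \<open>u \<in> N\<close> \<open>v \<in> N\<close> by (auto simp: N_def)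
        moreover have "linked (V - set zs) f g"
          using \<open>f \<in> F\<close> \<open>g \<in> F\<close> linked_sym linked_trans unfolding F_def by blast
        ultimately show ?thesis
          using sym unfolding linked_def by blast
      qed
      \<comment> \<open>Otherwise two attachments have adjacent successors, and an ear through
        \<open>F\<close> lengthens the cycle.\<close>
      have N_small: "card N \<le> k"
      proof (rule ccontr)
        assume "\<not> card N \<le> k"
        then have "k < card N"
          by simp
        moreover have "N \<subseteq> set zs"
          by (auto simp: N_def)
        ultimately obtain A B C where ABC: "zs = A @ B @ C" "A \<noteq> []" "B \<noteq> []" "last A \<in> N" "last B \<in> N"
            "E (hd B) (hd (C @ A))"
          using is_cycle_successor_edge[OF zs] by metis
        obtain Q where Q: "is_path Q" "set Q \<inter> set zs = {}" "E (last A) (hd Q)" "E (last Q) (last B)"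
          using ear ABC by blast
        then have "is_cycle (A @ Q @ rev B @ C)"
          using ABC zs by (intro is_cycle_insert) auto
        then show False
          using longest[of "A @ Q @ rev B @ C"] ABC(1) Q(1) by (auto simp: is_path_def)
      qed
      \<comment> \<open>Otherwise an ear could replace the edge between two consecutive
        vertices.\<close>
      have "\<not> set zs \<subseteq> N"
      proof
        assume N: "set zs \<subseteq> N"
        obtain a b cs where abc: "zs = a # b # cs"
          using zs by (auto simp: is_cycle_def numeral_eq_Suc Suc_le_length_iff)
        then obtain Q where Q: "is_path Q" "set Q \<inter> set zs = {}" "E a (hd Q)" "E (last Q) b"
          using ear[of a b] N by auto
        then have "is_cycle ([a] @ Q @ b # cs)"
          using zs abc by (auto simp: is_cycle_def is_path_def successively_Cons successively_append_iff)
        then show False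
          using longest[of "[a] @ Q @ b # cs"] abc Q(1) by (auto simp: is_path_def)
      qed
      then obtain u where u: "u \<in> set zs" "u \<notin> N"
        by blast
      have NV: "N \<subseteq> V" "w \<notin> N" "u \<in> V"
        using is_cycle_subset_V[OF zs] w' u by (auto simp: N_def)
      then have "linked (V - N) w u"
        using conn N_small w u by blast
      then have "u \<in> F"
      proof (rule linked_closed[OF _ F(1)])
        fix f v assume fv: "f \<in> F" "E f v" "v \<in> V - N"
        then have "v \<notin> set zs"
          using sym by (auto simp: N_def)
        then show "v \<in> F"
          using fv linked_step[of "V - set zs" w f v] by (auto simp: F_def)
      qed
      then show False
        using F(2) u(1) by blast
    qed
  qed
  then show ?thesis
    using zs is_cycle_subset_V[OF zs] by blast
qed

end

section \<open>Transfer to the digraph representation\<close>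

context graph
begin

lemma finite_independent_sets: "finite {S. independent_set G S}"
  by (rule finite_subset[of _ "Pow (verts G)"]) (auto simp: independent_set_def)

lemma alpha_graph:
  assumes "verts G \<noteq> {}"
  shows "alpha_graph (verts G) (dominates G) (independence_number G)"
proof
  show "finite (verts G)"
    by simp
  show "v \<rightarrow>\<^bsub>G\<^esub> u" if "u \<rightarrow>\<^bsub>G\<^esub> v" for u v
    using that by (rule graph_symmetric)
  show "\<not> u \<rightarrow>\<^bsub>G\<^esub> u" for u
    using adj_not_same by blast
  show "u \<in> verts G" if "u \<rightarrow>\<^bsub>G\<^esub> v" for u v
    using that by (rule adj_in_verts)
  have card_le: "card S \<le> independence_number G" if "independent_set G S" for S
    unfolding independence_number_def
    using that by (intro Max_ge finite_imageI finite_independent_sets) auto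
  show "\<exists>u\<in>X. \<exists>v\<in>X. u \<rightarrow>\<^bsub>G\<^esub> v" if "X \<subseteq> verts G" "independence_number G < card X" for X
    using card_le[of X] that by (auto simp: independent_set_def)
  obtain v where "v \<in> verts G"
    using assms by blast
  then have "independent_set G {v}"
    using adj_not_same by (auto simp: independent_set_def)
  from card_le[OF this] show "0 < independence_number G"
    by simp
qed

text \<open>Without parallel arcs, \<open>head G\<close> maps the arcs leaving \<open>v\<close>
  bijectively to its neighbours.\<close>

lemma card_neighbours: "card {w \<in> verts G. v \<rightarrow>\<^bsub>G\<^esub> w} = out_degree G v"
proof -
  have "{w \<in> verts G. v \<rightarrow>\<^bsub>G\<^esub> w} = head G ` out_arcs G v"
    by (auto simp: arcs_ends_conv out_arcs_def)
  moreover have "inj_on (head G) (out_arcs G v)"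
    by (auto simp: inj_on_def arc_to_ends_def intro!: no_multi_arcs)
  ultimately show ?thesis
    by (simp add: card_image out_degree_def)
qed

section \<open>Closed walks and vertex lists\<close>

lemma successively_awalk_verts:
  "awalk u p v \<Longrightarrow> successively (dominates G) (awalk_verts u p)"
proof (induction p arbitrary: u)
  case (Cons e p)
  then have e: "e \<in> arcs G" "u = tail G e" "awalk (head G e) p v"
    by (auto simp: awalk_Cons_iff)
  then have "hd (awalk_verts (head G e) p) = head G e"
    by (intro awhd_if_cas) auto
  moreover have "tail G e \<rightarrow>\<^bsub>G\<^esub> head G e"
    using e by (auto simp: arcs_ends_conv)
  ultimately show ?case
    using Cons.IH[OF e(3)] by (simp add: successively_Cons)
qed simp

lemma awalk_of_successively:
  assumes "successively (dominates G) ws" "ws \<noteq> []" "set ws \<subseteq> verts G"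
  shows "\<exists>p. awalk (hd ws) p (last ws) \<and> awalk_verts (hd ws) p = ws"
  using assms
proof (induction ws)
  case (Cons w ws)
  show ?case
  proof (cases "ws = []")
    case True
    then show ?thesis
      using Cons.prems by (intro exI[of _ "[]"]) (auto simp: awalk_Nil_iff)
  next
    case False
    then obtain p where p: "awalk (hd ws) p (last ws)" "awalk_verts (hd ws) p = ws"
      using Cons by (auto simp: successively_Cons)
    obtain e where "e \<in> arcs G" "tail G e = w" "head G e = hd ws"
      using Cons.prems(1) False by (auto simp: successively_Cons)
    then show ?thesis
      using p False by (intro exI[of _ "e # p"]) (auto simp: awalk_Cons_iff)
  qed
qed simp

lemma simple_cycle_iff_vertex_list:
  assumes "verts G \<noteq> {}"
  shows "(\<exists>p. simple_cycle G p \<and> length p = l)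
    \<longleftrightarrow> (\<exists>zs. alpha_graph.is_cycle (dominates G) zs \<and> length zs = l)"
proof -
  interpret A: alpha_graph "verts G" "dominates G" "independence_number G"
    by (rule alpha_graph[OF assms])
  show ?thesis
  proof
    assume "\<exists>p. simple_cycle G p \<and> length p = l"
    then obtain p u where p: "awalk u p u" "distinct (tl (awalk_verts u p))" "3 \<le> length p" "length p = l"
      by (auto simp: simple_cycle_def cycle_def)
    have "p \<noteq> []"
      using p(3) by auto
    have "awlast u p = u"
      using p(1) by auto
    \<comment> \<open>The vertex sequence of a closed walk repeats \<open>u\<close> at its end; the
      tails list each vertex once.\<close>
    then have verts: "awalk_verts u p = map (tail G) p @ [u]"
      using \<open>p \<noteq> []\<close> by (auto simp: awalk_verts_conv)
    have "tail G (hd p) = u"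
      using p(1) \<open>p \<noteq> []\<close> by (cases p) (auto simp: awalk_Cons_iff)
    then have "distinct (map (tail G) p)"
      using p(2) \<open>p \<noteq> []\<close> unfolding verts by (cases p) auto
    moreover have "successively (dominates G) (map (tail G) p @ [u])"
      using successively_awalk_verts[OF p(1)] verts by simp
    ultimately have "A.is_cycle (map (tail G) p)"
      using p(3) \<open>p \<noteq> []\<close> \<open>tail G (hd p) = u\<close>
      by (auto simp: A.is_cycle_def successively_append_iff hd_map)
    then show "\<exists>zs. A.is_cycle zs \<and> length zs = l"
      using p(4) by (intro exI[of _ "map (tail G) p"]) simp
  next
    assume "\<exists>zs. A.is_cycle zs \<and> length zs = l"
    then obtain zs where zs: "A.is_cycle zs" "length zs = l"
      by blast
    then have "zs \<noteq> []"
      by (auto simp: A.is_cycle_def)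
    have "successively (dominates G) (zs @ [hd zs])" "set (zs @ [hd zs]) \<subseteq> verts G"
      using zs(1) A.is_cycle_subset_V[OF zs(1)] \<open>zs \<noteq> []\<close>
      by (auto simp: A.is_cycle_def successively_append_iff)
    then obtain p where p: "awalk (hd (zs @ [hd zs])) p (last (zs @ [hd zs]))"
        "awalk_verts (hd (zs @ [hd zs])) p = zs @ [hd zs]"
      using awalk_of_successively[of "zs @ [hd zs]"] by blast
    have "length p = l"
      using length_awalk_verts[of "hd (zs @ [hd zs])" p] p(2) zs(2) by simp
    moreover have "distinct (tl zs @ [hd zs])"
      using zs(1) \<open>zs \<noteq> []\<close> by (cases zs) (auto simp: A.is_cycle_def)
    ultimately have "simple_cycle G p"
      using p zs \<open>zs \<noteq> []\<close> unfolding simple_cycle_def cycle_def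
      by (auto simp: A.is_cycle_def hd_append intro!: exI[of _ "hd zs"])
    then show "\<exists>p. simple_cycle G p \<and> length p = l"
      using \<open>length p = l\<close> by blast
  qed
qed

section \<open>Vertex connectivity\<close>

lemma linked_of_connected:
  assumes "verts G \<noteq> {}" and W: "connected (G \<restriction> W)" "x \<in> W" "y \<in> W"
  shows "alpha_graph.linked (dominates G) W x y"
proof -
  interpret A: alpha_graph "verts G" "dominates G" "independence_number G"
    by (rule alpha_graph[OF assms(1)])
  have "(x, y) \<in> rtrancl_on W (parcs (mk_symmetric (G \<restriction> W)))"
    using W by (auto simp: connected_def strongly_connected_def reachable_def mk_symmetric_def)
  then show ?thesis
  proof (induction rule: rtrancl_on_induct)
    case base
    then show ?case
      by (rule A.linked_refl)
  next
    case (step y z)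
    have "y \<rightarrow>\<^bsub>G\<^esub> z"
      using step(2) graph_symmetric by (auto simp: mk_symmetric_def arcs_ends_conv)
    then show ?case
      using A.linked_step step by blast
  qed
qed

lemma vertex_connectivity_le_cut:
  assumes "\<not> complete_digraph (card (verts G)) G" "vertex_cut G S"
  shows "vertex_connectivity G \<le> card S"
proof -
  have "finite {S. vertex_cut G S}"
    by (rule finite_subset[of _ "Pow (verts G)"]) (auto simp: vertex_cut_def)
  then show ?thesis
    using assms by (auto simp: vertex_connectivity_def)
qed

lemma linked_of_vertex_connectivity:
  assumes ne: "verts G \<noteq> {}" and S: "S \<subseteq> verts G" "card S < vertex_connectivity G"
    and xy: "x \<in> verts G - S" "y \<in> verts G - S"
  shows "alpha_graph.linked (dominates G) (verts G - S) x y"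
proof -
  interpret A: alpha_graph "verts G" "dominates G" "independence_number G"
    by (rule alpha_graph[OF ne])
  show ?thesis
  proof (cases "complete_digraph (card (verts G)) G")
    case True
    show ?thesis
    proof (cases "x = y")
      case True
      then show ?thesis
        using xy A.linked_refl by blast
    next
      case False
      then have "x \<rightarrow>\<^bsub>G\<^esub> y"
        using True xy by (auto simp: complete_digraph_def)
      then show ?thesis
        using A.linked_step[OF A.linked_refl] xy by blast
    qed
  next
    case False
    then have "\<not> vertex_cut G S"
      using vertex_connectivity_le_cut S(2) by fastforce
    then have "connected (G \<restriction> (verts G - S))"
      using S(1) xy by (auto simp: vertex_cut_def)
    then show ?thesis
      using linked_of_connected ne xy by blast
  qed
qed

text \<open>In a graph that is not complete, deleting all but two non-adjacent vertices gives a cut, so the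
  number of vertices exceeds the connectivity.\<close>

lemma vertex_connectivity_less_card:
  assumes ne: "verts G \<noteq> {}"
  shows "vertex_connectivity G < card (verts G)"
proof (cases "complete_digraph (card (verts G)) G")
  case True
  then show ?thesis
    using ne by (simp add: vertex_connectivity_def card_gt_0_iff)
next
  case False
  interpret A: alpha_graph "verts G" "dominates G" "independence_number G"
    by (rule alpha_graph[OF ne])
  have "arcs_ends G \<noteq> {(u, v). (u, v) \<in> verts G \<times> verts G \<and> u \<noteq> v}"
    using False graph_axioms by (auto simp: complete_digraph_def)
  then obtain a b where ab: "a \<in> verts G" "b \<in> verts G" "a \<noteq> b" "\<not> a \<rightarrow>\<^bsub>G\<^esub> b"
    using A.E_in_V A.E_in_V2 A.irrefl by auto
  have eq: "verts G - (verts G - {a, b}) = {a, b}"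
    using ab by auto
  have "\<not> A.linked {a, b} a b"
    using A.linked_closed[of "{a, b}" a b "{a}"] ab by auto
  then have "vertex_cut G (verts G - {a, b})"
    using linked_of_connected[OF ne, of "{a, b}" a b] ab unfolding vertex_cut_def eq by auto
  then have "vertex_connectivity G \<le> card (verts G - {a, b})"
    by (rule vertex_connectivity_le_cut[OF False])
  also have "\<dots> < card (verts G)"
    using ab by (intro psubset_card_mono) auto
  finally show ?thesis .
qed

text \<open>Deleting the neighbours of \<open>v\<close> isolates it. Were they fewer than the
  connectivity, no other vertex could remain, and the graph would have too few vertices.\<close>

lemma vertex_connectivity_le_degree:
  assumes ne: "verts G \<noteq> {}" and v: "v \<in> verts G"
  shows "vertex_connectivity G \<le> card {w \<in> verts G. v \<rightarrow>\<^bsub>G\<^esub> w}"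
proof (rule ccontr)
  interpret A: alpha_graph "verts G" "dominates G" "independence_number G"
    by (rule alpha_graph[OF ne])
  define S where "S = {w \<in> verts G. v \<rightarrow>\<^bsub>G\<^esub> w}"
  assume "\<not> vertex_connectivity G \<le> card {w \<in> verts G. v \<rightarrow>\<^bsub>G\<^esub> w}"
  then have S: "card S < vertex_connectivity G" "S \<subseteq> verts G" "v \<notin> S"
    using A.irrefl by (auto simp: S_def)
  have "verts G \<subseteq> insert v S"
  proof
    fix w assume "w \<in> verts G"
    show "w \<in> insert v S"
    proof (rule ccontr)
      assume "w \<notin> insert v S"
      then have "A.linked (verts G - S) v w"
        using S v \<open>w \<in> verts G\<close> by (intro linked_of_vertex_connectivity ne) auto
      then have "w \<in> {v}"
        by (rule A.linked_closed) (auto simp: S_def)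
      then show False
        using \<open>w \<notin> insert v S\<close> by simp
    qed
  qed
  then have "card (verts G) \<le> card (insert v S)"
    using finite_subset[OF S(2)] by (intro card_mono) auto
  also have "\<dots> \<le> Suc (card S)"
    by (rule card_insert_le_m1) simp_all
  finally show False
    using S(1) vertex_connectivity_less_card[OF ne] by linarith
qed

end

theorem theorem1p1:
  fixes G :: "('a, 'b) pre_digraph"
  assumes "graph G" and "verts G \<noteq> {}"
  shows "(hamiltonian G \<and> min_degree G \<ge> 600 * independence_number G \<longrightarrow> pancyclic G)
       \<and> (vertex_connectivity G \<ge> 600 * independence_number G \<longrightarrow> pancyclic G)"
proof -
  interpret graph G
    by (rule assms)
  let ?k = "independence_number G"
  interpret A: alpha_graph "verts G" "dominates G" ?k
    by (rule alpha_graph[OF assms(2)])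
  have pancyclic: "pancyclic G"
    if "A.is_cycle zs" "set zs = verts G" "\<And>v. v \<in> verts G \<Longrightarrow> 600 * ?k \<le> A.deg v (verts G)" for zs
    unfolding pancyclic_def simple_cycle_iff_vertex_list[OF assms(2)]
    using A.all_cycle_lengths[OF that] by blast
  show ?thesis
  proof (intro conjI impI)
    assume *: "hamiltonian G \<and> 600 * ?k \<le> min_degree G"
    then obtain zs where zs: "A.is_cycle zs" "length zs = card (verts G)"
      using simple_cycle_iff_vertex_list[OF assms(2)] by (auto simp: hamiltonian_def)
    then have "set zs = verts G"
      using A.is_cycle_subset_V[OF zs(1)]
      by (intro card_subset_eq) (auto simp: A.is_cycle_def distinct_card)
    moreover have "600 * ?k \<le> A.deg v (verts G)" if "v \<in> verts G" for v
    proof -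
      have "600 * ?k \<le> min_degree G"
        using * by simp
      also have "\<dots> \<le> out_degree G v"
        unfolding min_degree_def using that by (intro Min_le) auto
      finally show ?thesis
        by (simp add: A.deg_def A.nb_def card_neighbours)
    qed
    ultimately show "pancyclic G"
      using pancyclic zs(1) by blast
  next
    assume *: "600 * ?k \<le> vertex_connectivity G"
    have deg: "600 * ?k \<le> A.deg v (verts G)" if "v \<in> verts G" for v
      using * vertex_connectivity_le_degree[OF assms(2) that] by (simp add: A.deg_def A.nb_def)
    \<comment> \<open>A triangle, so that a longest cycle exists.\<close>
    then obtain ys where "A.is_cycle ys"
      using A.short_cycles[OF assms(2), of 3] A.k_pos by auto
    moreover have "A.linked (verts G - S) x y"
      if "S \<subseteq> verts G" "card S \<le> ?k" "x \<in> verts G - S" "y \<in> verts G - S" for S x y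
      using that * A.k_pos by (intro linked_of_vertex_connectivity assms(2)) auto
    ultimately obtain zs where "A.is_cycle zs" "set zs = verts G"
      using A.chvatal_erdos by blast
    then show "pancyclic G"
      using pancyclic deg by blast
  qed
qed

end
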